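(* Let $\alpha>0$, $\gamma>0$, $\sigma>0$, $T>0$, $d>\alpha/\gamma$, $x\in[0,d]$, and let $x(t)=\frac{\alpha}{\gamma}+\left(x-\frac{\alpha}{\gamma}\right)e^{-\gamma t}$. For $\epsilon>0$ let $Z^\epsilon$ be the Ornstein-Uhlenbeck process doubly reflected at $0$ and $d$, with $Z^\epsilon_0=x$ and $$\mathrm{d}Z^{\epsilon}_{t}=(\alpha-\gamma Z^{\epsilon}_{t})\,\mathrm{d}t+\sqrt{\epsilon}\,\sigma\, \mathrm{d}B_{t}+\mathrm{d}L^{\epsilon}_{t}-\mathrm{d}U^\epsilon_t.$$ Let $d\geqslant b>x(T)$. Then $$\lim_{\epsilon\to 0}\epsilon \log\mathbb{P}_x(Z^{\epsilon}_{T}\geqslant b)=-\frac{\left[b-\left(\frac{\alpha}{\gamma}+(x-\frac{\alpha}{\gamma})e^{-\gamma T}\right)\right]^{2}}{[1-e^{-2\gamma T}]\,\sigma^{2}/\gamma}.$$ Moreover, the minimal cost path, i.e. the minimizer of $I^{++}_x$ over $S^{++}:=\{f\in C_{[0,T]}([0,d]): f(0)=x,\ f(T)\geqslant b\}$, is $$f^\star(t)=\left(C-\frac{\alpha}{\gamma}\right)e^{\gamma t}+(x-C)e^{-\gamma t}+\frac{\alpha}{\gamma},\qquad C=\frac{b-\frac{\alpha}{\gamma}+\frac{\alpha}{\gamma}e^{\gamma T}-xe^{-\gamma T}}{e^{\gamma T}-e^{-\gamma T}}.$$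
   Context: $B$ is a standard Brownian motion. $L^\epsilon$ and $U^\epsilon$ are the minimal nondecreasing continuous processes, started at $0$, that keep $Z^\epsilon_t\in[0,d]$ for all $t\geqslant0$; they satisfy $\int_{[0,t]}\mathbf{1}_{\{Z^\epsilon_s>0\}}\,\mathrm{d}L^\epsilon_s=0$ and $\int_{[0,t]}\mathbf{1}_{\{Z^\epsilon_s<d\}}\,\mathrm{d}U^\epsilon_s=0$ for every $t>0$. The doubly reflected equation has a unique strong solution. $\mathbb{P}_x$ denotes probability when the process starts in $x$. $C_{[0,T]}([0,d])$ is the space of continuous functions $[0,T]\to[0,d]$ with the uniform norm. $H_x:=\{f:[0,T]\to\mathbb{R}: f(t)=x+\int_0^t\phi(s)\,\mathrm{d}s,\ \phi\in L_2([0,T])\}$ and $H_x^{++}:=\{f\in H_x:0\leqslant f\leqslant d\}$. The functional $I_x^{++}$ on $C_{[0,T]}([0,d])$ is $$I_x^{++}(h)=\frac{1}{2\sigma^2}\int_0^T\left(h'(t)-\alpha+\gamma h(t)\right)^2\mathrm{d}t\ \text{ if } h\in H_x^{++},\qquad I_x^{++}(h)=\infty\ \text{ otherwise}$$ (it is the rate function of the sample-path large deviations principle for $Z^\epsilon$).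
   Formalization: The probability limit is stated only for b < d, since for b = d one has P(Z_T ≥ d) = P(Z_T = d) = 0 for every ε > 0, so the printed finite limit fails; the minimal-path claim keeps d ≥ b > x(T). *)

theory Defs
  imports "HOL-Probability.Probability"
begin

definition standard_brownian_motion :: "'a measure \<Rightarrow> (real \<Rightarrow> 'a \<Rightarrow> real) \<Rightarrow> bool" where
  "standard_brownian_motion M B \<longleftrightarrow>
     prob_space M \<and>
     (\<forall>t\<ge>0. B t \<in> borel_measurable M) \<and>
     (AE \<omega> in M. B 0 \<omega> = 0) \<and>
     (\<forall>s t. 0 \<le> s \<and> s < t \<longrightarrow>
        distributed M lborel (\<lambda>\<omega>. B t \<omega> - B s \<omega>) (normal_density 0 (sqrt (t - s)))) \<and>
     (\<forall>(n::nat) (\<tau> :: nat \<Rightarrow> real). 0 \<le> \<tau> 0 \<and> (\<forall>i<n. \<tau> i < \<tau> (Suc i)) \<longrightarrow>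
        prob_space.indep_vars M (\<lambda>_. borel) (\<lambda>i \<omega>. B (\<tau> (Suc i)) \<omega> - B (\<tau> i) \<omega>) {..<n}) \<and>
     (AE \<omega> in M. continuous_on {0..} (\<lambda>t. B t \<omega>))"

text \<open>Pathwise notions, for a fixed noise path \<open>w\<close>. The diffusion coefficient is constant, so the
  stochastic integral against \<open>B\<close> is the coefficient times \<open>B\<close>, and the reflected equation can be
  read path by path. In \<open>regulated_path\<close>, \<open>l\<close> and \<open>u\<close> are any nondecreasing controls keeping \<open>z\<close>
  in \<open>[0, d]\<close>; these are the competitors in the minimality clause of \<open>doubly_reflected_path\<close>.\<close>

definition regulated_path ::
  "real \<Rightarrow> real \<Rightarrow> real \<Rightarrow> real \<Rightarrow> (real \<Rightarrow> real) \<Rightarrow> (real \<Rightarrow> real) \<Rightarrow> (real \<Rightarrow> real) \<Rightarrow> (real \<Rightarrow> real) \<Rightarrow> bool"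
  where
  "regulated_path \<alpha> \<gamma> d x w z l u \<longleftrightarrow>
     continuous_on {0..} z \<and> continuous_on {0..} l \<and> continuous_on {0..} u \<and>
     mono_on {0..} l \<and> mono_on {0..} u \<and> l 0 = 0 \<and> u 0 = 0 \<and>
     (\<forall>t\<ge>0. z t \<in> {0..d}) \<and>
     (\<forall>t\<ge>0. z t = x + (LBINT s:{0..t}. \<alpha> - \<gamma> * z s) + w t + l t - u t)"

text \<open>Lebesgue-Stieltjes measure of a path that is nondecreasing and continuous on \<open>[0, \<infinity>)\<close> and
  starts at \<open>0\<close>; the path is continued by \<open>l 0\<close> to the left of \<open>0\<close>.\<close>

definition stieltjes :: "(real \<Rightarrow> real) \<Rightarrow> real measure" where
  "stieltjes l = interval_measure (\<lambda>t. l (max 0 t))"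

definition doubly_reflected_path ::
  "real \<Rightarrow> real \<Rightarrow> real \<Rightarrow> real \<Rightarrow> (real \<Rightarrow> real) \<Rightarrow> (real \<Rightarrow> real) \<Rightarrow> (real \<Rightarrow> real) \<Rightarrow> (real \<Rightarrow> real) \<Rightarrow> bool"
  where
  "doubly_reflected_path \<alpha> \<gamma> d x w z l u \<longleftrightarrow>
     regulated_path \<alpha> \<gamma> d x w z l u \<and>
     (\<forall>z' l' u'. regulated_path \<alpha> \<gamma> d x w z' l' u' \<longrightarrow> (\<forall>t\<ge>0. l t \<le> l' t \<and> u t \<le> u' t)) \<and>
     (\<forall>t>0. (\<integral>\<^sup>+s\<in>{0..t}. indicator {s. z s > 0} s \<partial>stieltjes l) = 0) \<and>
     (\<forall>t>0. (\<integral>\<^sup>+s\<in>{0..t}. indicator {s. z s < d} s \<partial>stieltjes u) = 0)"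

text \<open>\<open>Z\<close> solves \<open>dZ = (\<alpha> - \<gamma> Z) dt + \<beta> dB + dL - dU\<close>, \<open>Z 0 = x\<close>, reflected at \<open>0\<close> and \<open>d\<close>.\<close>

definition doubly_reflected_OU ::
  "'a measure \<Rightarrow> (real \<Rightarrow> 'a \<Rightarrow> real) \<Rightarrow> real \<Rightarrow> real \<Rightarrow> real \<Rightarrow> real \<Rightarrow> real \<Rightarrow>
   (real \<Rightarrow> 'a \<Rightarrow> real) \<Rightarrow> (real \<Rightarrow> 'a \<Rightarrow> real) \<Rightarrow> (real \<Rightarrow> 'a \<Rightarrow> real) \<Rightarrow> bool" where
  "doubly_reflected_OU M B \<alpha> \<gamma> \<beta> d x Z L U \<longleftrightarrow>
     (\<forall>t\<ge>0. Z t \<in> borel_measurable M \<and> L t \<in> borel_measurable M \<and> U t \<in> borel_measurable M) \<and>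
     (AE \<omega> in M. doubly_reflected_path \<alpha> \<gamma> d x
        (\<lambda>t. \<beta> * B t \<omega>) (\<lambda>t. Z t \<omega>) (\<lambda>t. L t \<omega>) (\<lambda>t. U t \<omega>))"

text \<open>Functions on \<open>[0, T]\<close> are represented by elements of \<^term>\<open>extensional {0..T}\<close>, so that equality
  of representatives is equality on \<open>[0, T]\<close>.\<close>

definition path_space :: "real \<Rightarrow> real \<Rightarrow> (real \<Rightarrow> real) set" where
  "path_space T d = {f \<in> {0..T} \<rightarrow>\<^sub>E {0..d}. continuous_on {0..T} f}"

definition L2_path :: "real \<Rightarrow> (real \<Rightarrow> real) \<Rightarrow> bool" where
  "L2_path T \<phi> \<longleftrightarrow> set_borel_measurable lborel {0..T} \<phi> \<and>
     set_integrable lborel {0..T} (\<lambda>t. (\<phi> t)\<^sup>2)"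

definition has_L2_derivative :: "real \<Rightarrow> real \<Rightarrow> (real \<Rightarrow> real) \<Rightarrow> (real \<Rightarrow> real) \<Rightarrow> bool" where
  "has_L2_derivative T x f \<phi> \<longleftrightarrow> L2_path T \<phi> \<and> (\<forall>t\<in>{0..T}. f t = x + (LBINT s:{0..t}. \<phi> s))"

definition H :: "real \<Rightarrow> real \<Rightarrow> (real \<Rightarrow> real) set" where
  "H T x = {f \<in> extensional {0..T}. \<exists>\<phi>. has_L2_derivative T x f \<phi>}"

definition Hpp :: "real \<Rightarrow> real \<Rightarrow> real \<Rightarrow> (real \<Rightarrow> real) set" where
  "Hpp T d x = {f \<in> H T x. \<forall>t\<in>{0..T}. 0 \<le> f t \<and> f t \<le> d}"

text \<open>For \<open>h\<close> in \<^term>\<open>H T x\<close> the derivative \<open>h'\<close> is an element of \<open>L\<^sub>2\<close>, i.e. a function determined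
  up to null sets (lemma \<open>path_deriv_eq\<close> below); we choose a representative.\<close>

definition path_deriv :: "real \<Rightarrow> real \<Rightarrow> (real \<Rightarrow> real) \<Rightarrow> real \<Rightarrow> real" where
  "path_deriv T x h = (SOME \<phi>. has_L2_derivative T x h \<phi>)"

definition rate_pp ::
  "real \<Rightarrow> real \<Rightarrow> real \<Rightarrow> real \<Rightarrow> real \<Rightarrow> real \<Rightarrow> (real \<Rightarrow> real) \<Rightarrow> ereal" where
  "rate_pp \<alpha> \<gamma> \<sigma> T d x h =
     (if h \<in> Hpp T d x
      then ereal (1 / (2 * \<sigma>\<^sup>2) * (LBINT t:{0..T}. (path_deriv T x h t - \<alpha> + \<gamma> * h t)\<^sup>2))
      else \<infinity>)"

definition Spp :: "real \<Rightarrow> real \<Rightarrow> real \<Rightarrow> real \<Rightarrow> (real \<Rightarrow> real) set" where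
  "Spp T d x b = {f \<in> path_space T d. f 0 = x \<and> f T \<ge> b}"

lemma L2_path_integrable:
  assumes "L2_path T \<phi>"
  shows "set_integrable lborel {0..T} \<phi>"
proof -
  have 1: "set_integrable lborel {0..T} (\<lambda>t. 1 + (\<phi> t)\<^sup>2)"
    using assms unfolding L2_path_def
    by (intro set_integral_add(1)) (auto intro: borel_integrable_atLeastAtMost')
  have "norm (indicator {0..T} t *\<^sub>R \<phi> t) \<le> norm (indicator {0..T} t *\<^sub>R (1 + (\<phi> t)\<^sup>2))" for t
  proof -
    have "0 \<le> (\<bar>\<phi> t\<bar> - 1)\<^sup>2" "0 \<le> (\<phi> t)\<^sup>2" by simp_all
    then have "\<bar>\<phi> t\<bar> \<le> 1 + (\<phi> t)\<^sup>2" by (simp add: power2_eq_square algebra_simps)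
    then show ?thesis by (simp add: indicator_def)
  qed
  with 1 assms show ?thesis unfolding set_integrable_def L2_path_def set_borel_measurable_def
    by (blast intro: Bochner_Integration.integrable_bound)
qed

lemma AE_zero_if_integrals_zero:
  fixes g :: "real \<Rightarrow> real"
  assumes g: "integrable lborel g" and z: "\<And>t. (LBINT s:{t<..}. g s) = 0"
  shows "AE s in lborel. g s = 0"
proof -
  let ?p = "\<lambda>s. ennreal (max 0 (g s))" and ?n = "\<lambda>s. ennreal (max 0 (- g s))"
  have [measurable]: "g \<in> borel_measurable borel" using g by simp
  have eq: "emeasure (density lborel ?p) {t<..} = ennreal (LBINT s:{t<..}. max 0 (g s))"
           "emeasure (density lborel ?n) {t<..} = ennreal (LBINT s:{t<..}. max 0 (- g s))" for t
  proof -
    have "integrable lborel (\<lambda>s. indicator {t<..} s *\<^sub>R max 0 (g s))"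
      "integrable lborel (\<lambda>s. indicator {t<..} s *\<^sub>R max 0 (- g s))"
      using g by (intro integrable_mult_indicator integrable_max; simp)+
    then show "emeasure (density lborel ?p) {t<..} = ennreal (LBINT s:{t<..}. max 0 (g s))"
      "emeasure (density lborel ?n) {t<..} = ennreal (LBINT s:{t<..}. max 0 (- g s))"
      unfolding set_lebesgue_integral_def
      by (subst nn_integral_eq_integral [symmetric];
          auto simp: emeasure_density indicator_def intro!: nn_integral_cong)+
  qed
  have same: "(LBINT s:{t<..}. max 0 (g s)) = (LBINT s:{t<..}. max 0 (- g s))" for t
  proof -
    have "(LBINT s:{t<..}. max 0 (g s)) - (LBINT s:{t<..}. max 0 (- g s)) = (LBINT s:{t<..}. g s)"
      unfolding set_lebesgue_integral_def
      by (subst Bochner_Integration.integral_diff [symmetric],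
          (intro integrable_mult_indicator integrable_max; use g in simp)+)
         (intro Bochner_Integration.integral_cong, auto simp: max_def indicator_def)
    with z show ?thesis by simp
  qed
  have "density lborel ?p = density lborel ?n"
    by (rule measure_eqI_lessThan) (simp_all only: eq same sets_density sets_lborel infinity_ennreal_def ennreal_less_top)
  then have "AE s in lborel. ?p s = ?n s"
    by (intro sigma_finite_measure.density_unique [OF sigma_finite_lborel]) auto
  then show ?thesis by eventually_elim (auto simp: max_def split: if_splits)
qed

lemma path_deriv_eq:
  assumes "has_L2_derivative T x h \<phi>"
  shows "has_L2_derivative T x h (path_deriv T x h)"
    and "AE t in lborel. t \<in> {0..T} \<longrightarrow> path_deriv T x h t = \<phi> t"
proof -
  show *: "has_L2_derivative T x h (path_deriv T x h)"
    unfolding path_deriv_def by (rule someI [where P = "has_L2_derivative T x h", OF assms])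
  define \<psi> where "\<psi> = path_deriv T x h"
  define g where "g s = indicator {0..T} s *\<^sub>R (\<psi> s - \<phi> s)" for s
  have i: "set_integrable lborel {0..T} \<psi>" "set_integrable lborel {0..T} \<phi>"
    using * assms by (auto simp: \<psi>_def has_L2_derivative_def intro: L2_path_integrable)
  then have ig: "set_integrable lborel {0..T} (\<lambda>s. \<psi> s - \<phi> s)" by simp
  have 0: "(LBINT s:{0..t}. \<psi> s - \<phi> s) = 0" if "t \<in> {0..T}" for t
  proof -
    have "set_integrable lborel {0..t} \<psi>" "set_integrable lborel {0..t} \<phi>"
      using i that by (auto intro: set_integrable_subset)
    then show ?thesis using * assms that
      by (simp add: \<psi>_def has_L2_derivative_def set_integral_diff)
  qed
  have "(LBINT s:{t<..}. g s) = 0" for t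
  proof -
    consider "T < 0 \<or> t \<ge> T" | "0 \<le> T" "t < 0" | "0 \<le> t" "t < T" by linarith
    then show ?thesis
    proof cases
      case 1
      then have "indicator {t<..} s *\<^sub>R g s = 0" for s
        by (auto simp: g_def indicator_def)
      then show ?thesis unfolding set_lebesgue_integral_def by (simp only: Bochner_Integration.integral_zero)
    next
      case 2
      then have "(LBINT s:{t<..}. g s) = (LBINT s:{0..T}. \<psi> s - \<phi> s)"
        unfolding set_lebesgue_integral_def g_def
        by (intro Bochner_Integration.integral_cong) (auto simp: indicator_def)
      with 0[of T] 2 show ?thesis by simp
    next
      case 3
      have "(LBINT s:{t<..}. g s) = (LBINT s:{t<..T}. \<psi> s - \<phi> s)"
        unfolding set_lebesgue_integral_def g_def using 3
        by (intro Bochner_Integration.integral_cong) (auto simp: indicator_def)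
      moreover have "(LBINT s:{0..t} \<union> {t<..T}. \<psi> s - \<phi> s) =
          (LBINT s:{0..t}. \<psi> s - \<phi> s) + (LBINT s:{t<..T}. \<psi> s - \<phi> s)"
        using 3 by (intro set_integral_Un set_integrable_subset[OF ig]) auto
      moreover have "{0..t} \<union> {t<..T} = {0..T}" using 3 by auto
      ultimately show ?thesis using 0[of t] 0[of T] 3 by simp
    qed
  qed
  moreover have "integrable lborel g" using ig by (simp add: set_integrable_def g_def [abs_def])
  ultimately have "AE s in lborel. g s = 0" by (rule AE_zero_if_integrals_zero[rotated])
  then show "AE t in lborel. t \<in> {0..T} \<longrightarrow> path_deriv T x h t = \<phi> t"
    by eventually_elim (auto simp: g_def \<psi>_def)
qed

end

theory Submission
  imports Defs
begin

text \<open>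
  Multiplying by \<open>e\<^bsup>\<gamma>t\<^esup>\<close> turns the reflected equation into
  \<open>e\<^bsup>\<gamma>t\<^esup> Z\<^sub>t = x + \<alpha>/\<gamma> (e\<^bsup>\<gamma>t\<^esup> - 1) + \<beta> J\<^sub>t + (push from L) - (push from U)\<close> with
  \<open>\<beta> = \<sigma> \<surd>\<epsilon>\<close> and \<open>J\<^sub>t = \<integral>\<^sub>0\<^sup>t e\<^bsup>\<gamma>s\<^esup> dB\<^sub>s\<close>. Put \<open>K = e\<^bsup>\<gamma>T\<^esup> (b - x(T))\<close> and
  \<open>Q = \<integral>\<^sub>0\<^sup>T e\<^bsup>2\<gamma>s\<^esup> ds\<close>; the claimed rate is \<open>K\<^sup>2 / (2 Q \<sigma>\<^sup>2)\<close>.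

  Upper bound: if \<open>Z\<^sub>T \<ge> b\<close>, then looking at the last visit to \<open>0\<close> gives some \<open>\<tau>\<close> with
  \<open>J\<^sub>T - J\<^sub>\<tau> \<ge> K / \<beta>\<close>, and the exponential maximal inequality for the time-reversed increments
  bounds the probability of this.

  Lower bound: \<open>Z\<close> dominates every unreflected path started at \<open>x - \<eta>\<close> that stays below \<open>d\<close>, so it
  suffices to show that, given \<open>J\<^sub>T \<ge> p\<close>, exceeding \<open>d\<close> is exponentially unlikely. Weighting with
  \<open>exp (p/Q J\<^sub>T)\<close> shifts the mean path to the optimal path from \<open>x - \<eta>\<close> to \<open>b\<close>, which stays below
  \<open>d\<close> by a fixed margin, and the same maximal inequality under this weight does the job.

  Minimizer: \<open>e\<^bsup>\<gamma>t\<^esup> (h' - \<alpha> + \<gamma> h)\<close> integrates to a quantity depending on \<open>h T\<close> only, so completing the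
  square with \<open>c e\<^bsup>\<gamma>t\<^esup>\<close>, \<open>c = K / Q\<close>, identifies the minimum and its unique minimizer.
\<close>

subsection \<open>Maximal inequality for tilted Gaussian sums\<close>

text \<open>Completing the square: the exponential factor moves the mean of the normal density from
  0 to \<open>\<theta> * \<sigma>\<^sup>2\<close> and leaves its mass at 1. This is the martingale
  step for both exponentials in the maximal inequality.\<close>

lemma nn_integral_normal_exp_tilt:
  assumes "\<sigma> > 0"
  shows "(\<integral>\<^sup>+y. ennreal (exp (\<theta> * y - \<theta>\<^sup>2 * \<sigma>\<^sup>2 / 2)) \<partial>density lborel (normal_density 0 \<sigma>)) = 1"
proof -
  have "normal_density 0 \<sigma> y * exp (\<theta> * y - \<theta>\<^sup>2 * \<sigma>\<^sup>2 / 2) = normal_density (\<theta> * \<sigma>\<^sup>2) \<sigma> y" for y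
    using assms by (simp add: normal_density_def mult_exp_exp) (simp add: field_simps power2_eq_square)
  then have "(\<integral>\<^sup>+y. ennreal (exp (\<theta> * y - \<theta>\<^sup>2 * \<sigma>\<^sup>2 / 2)) \<partial>density lborel (normal_density 0 \<sigma>)) =
      (\<integral>\<^sup>+y. ennreal (normal_density (\<theta> * \<sigma>\<^sup>2) \<sigma> y) \<partial>lborel)"
    by (subst nn_integral_density) (auto simp flip: ennreal_mult)
  also have "\<dots> = 1"
    using prob_space.emeasure_space_1[OF prob_space_normal_density[OF assms, of "\<theta> * \<sigma>\<^sup>2"]]
    by (simp add: emeasure_density)
  finally show ?thesis .
qed

lemma measurable_PiM_sum:
  fixes N :: "nat \<Rightarrow> real measure"
  assumes "\<And>i. sets (N i) = sets borel" and "k \<le> m"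
  shows "(\<lambda>x. \<Sum>i<k. x i) \<in> borel_measurable (Pi\<^sub>M {..<m} N)"
proof (rule borel_measurable_sum)
  fix i assume "i \<in> {..<k}"
  with assms have "i \<in> {..<m}" by auto
  then have "(\<lambda>x. x i) \<in> measurable (Pi\<^sub>M {..<m} N) (N i)" by (rule measurable_component_singleton)
  then show "(\<lambda>x. x i) \<in> borel_measurable (Pi\<^sub>M {..<m} N)"
    by (simp add: measurable_cong_sets[OF refl assms(1)])
qed

lemma measurable_PiM_crossing:
  fixes N :: "nat \<Rightarrow> real measure"
  assumes "\<And>i. sets (N i) = sets borel"
  shows "Measurable.pred (Pi\<^sub>M {..<m} N) (\<lambda>x. \<exists>k\<le>m. (\<Sum>i<k. x i) - c k \<ge> r)"
proof -
  have "Measurable.pred (Pi\<^sub>M {..<m} N) (\<lambda>x. \<exists>k\<in>{..m}. (\<Sum>i<k. x i) - c k \<ge> r)"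
  proof (rule pred_intros_finite)
    fix k assume "k \<in> {..m}"
    then have [measurable]: "(\<lambda>x. \<Sum>i<k. x i) \<in> borel_measurable (Pi\<^sub>M {..<m} N)"
      using assms by (intro measurable_PiM_sum) auto
    show "Measurable.pred (Pi\<^sub>M {..<m} N) (\<lambda>x. r \<le> (\<Sum>i<k. x i) - c k)" by measurable
  qed simp
  then show ?thesis by (simp only: Bex_def atMost_iff)
qed

text \<open>The integrand is a supermartingale in \<open>n\<close>: both branches are martingales, and the first
  crossing of level \<open>r\<close> switches to the smaller one.\<close>

lemma PiM_normal_tilted_maximal:
  fixes \<sigma> :: "nat \<Rightarrow> real"
  defines "V k \<equiv> \<Sum>i<k. (\<sigma> i)\<^sup>2"
  assumes pos: "\<And>i. \<sigma> i > 0" and "\<mu> \<ge> 0" and "\<mu>\<^sup>2 * V n / 2 + \<rho> \<le> \<mu> * r"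
  shows "(\<integral>\<^sup>+x. ennreal (if \<exists>k\<le>n. (\<Sum>i<k. x i) - \<theta> * V k \<ge> r
      then exp (\<theta> * (\<Sum>i<n. x i) - \<theta>\<^sup>2 * V n / 2)
      else exp (- \<rho>) * exp ((\<theta> + \<mu>) * (\<Sum>i<n. x i) - (\<theta> + \<mu>)\<^sup>2 * V n / 2))
    \<partial>(\<Pi>\<^sub>M i\<in>{..<n}. density lborel (normal_density 0 (\<sigma> i)))) \<le> ennreal (exp (- \<rho>))"
  using assms(4)
proof (induction n)
  case 0
  \<comment> \<open>With no increments the hypothesis reads \<rho> \<le> \<mu> * r. If level
    \<open>r\<close> is already crossed by the empty sum, the integrand is 1, and the bound needs
    \<rho> \<le> 0.\<close>
  then have "r \<le> 0 \<Longrightarrow> \<rho> \<le> 0"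
    using mult_nonneg_nonpos[OF \<open>\<mu> \<ge> 0\<close>, of r] by (simp add: V_def)
  then show ?case by (auto simp: V_def PiM_empty nn_integral_count_space_finite max_def)
next
  case (Suc n)
  define N where "N i = density lborel (normal_density 0 (\<sigma> i))" for i
  interpret product_sigma_finite N
    unfolding product_sigma_finite_def N_def
    by (blast intro: prob_space_imp_sigma_finite prob_space_normal_density pos)
  define g where "g n x = ennreal (if \<exists>k\<le>n. (\<Sum>i<k. x i) - \<theta> * V k \<ge> r
      then exp (\<theta> * (\<Sum>i<n. x i) - \<theta>\<^sup>2 * V n / 2)
      else exp (- \<rho>) * exp ((\<theta> + \<mu>) * (\<Sum>i<n. x i) - (\<theta> + \<mu>)\<^sup>2 * V n / 2))" for n and x :: "nat \<Rightarrow> real"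
  have VS: "V (Suc n) = V n + (\<sigma> n)\<^sup>2" by (simp add: V_def)
  \<comment> \<open>The induction hypothesis applies because \<open>V\<close> grows with the number
    of increments.\<close>
  have le: "\<mu>\<^sup>2 * V n / 2 + \<rho> \<le> \<mu> * r"
    using Suc.prems mult_left_mono[of "V n" "V (Suc n)" "\<mu>\<^sup>2"] unfolding VS by simp
  have g_meas: "g m \<in> borel_measurable (Pi\<^sub>M {..<m} N)" for m
  proof -
    define F where "F x \<longleftrightarrow> (\<exists>k\<le>m. (\<Sum>i<k. x i) - \<theta> * V k \<ge> r)" for x :: "nat \<Rightarrow> real"
    have [measurable]: "Measurable.pred (Pi\<^sub>M {..<m} N) F"
      "(\<lambda>x. \<Sum>i<m. x i) \<in> borel_measurable (Pi\<^sub>M {..<m} N)"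
      unfolding F_def[abs_def]
      by (rule measurable_PiM_crossing, simp add: N_def) (rule measurable_PiM_sum, simp_all add: N_def)
    show ?thesis unfolding g_def[abs_def] F_def[symmetric] by measurable
  qed
  have step: "(\<integral>\<^sup>+y. g (Suc n) (x(n := y)) \<partial>N n) \<le> g n x" for x
  proof (cases "\<exists>k\<le>n. (\<Sum>i<k. x i) - \<theta> * V k \<ge> r")
    case True
    then obtain k where k: "k \<le> n" "(\<Sum>i<k. x i) - \<theta> * V k \<ge> r" by blast
    have "g (Suc n) (x(n := y)) =
        ennreal (exp (\<theta> * (\<Sum>i<n. x i) - \<theta>\<^sup>2 * V n / 2)) * ennreal (exp (\<theta> * y - \<theta>\<^sup>2 * (\<sigma> n)\<^sup>2 / 2))" for y
    proof -
      have "(\<Sum>i<k. (x(n := y)) i) = (\<Sum>i<k. x i)" using k by (intro sum.cong) auto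
      then have ex: "\<exists>k\<le>Suc n. (\<Sum>i<k. (x(n := y)) i) - \<theta> * V k \<ge> r"
        using k by (intro exI[of _ k]) simp
      have S: "(\<Sum>i<Suc n. (x(n := y)) i) = (\<Sum>i<n. x i) + y" by simp
      show ?thesis
        by (simp only: g_def if_P[OF ex] S VS)
           (simp add: mult_exp_exp algebra_simps add_divide_distrib flip: ennreal_mult)
    qed
    then have "(\<integral>\<^sup>+y. g (Suc n) (x(n := y)) \<partial>N n) = g n x"
      using True by (simp add: nn_integral_cmult N_def nn_integral_normal_exp_tilt[OF pos] g_def)
    then show ?thesis by simp
  next
    case False
    have "g (Suc n) (x(n := y)) \<le>
        ennreal (exp (- \<rho>) * exp ((\<theta> + \<mu>) * (\<Sum>i<n. x i) - (\<theta> + \<mu>)\<^sup>2 * V n / 2)) *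
        ennreal (exp ((\<theta> + \<mu>) * y - (\<theta> + \<mu>)\<^sup>2 * (\<sigma> n)\<^sup>2 / 2))" for y
    proof -
      define S where "S = (\<Sum>i<n. x i) + y"
      have S: "(\<Sum>i<Suc n. (x(n := y)) i) = S" by (simp add: S_def)
      have rhs: "exp (- \<rho>) * exp ((\<theta> + \<mu>) * (\<Sum>i<n. x i) - (\<theta> + \<mu>)\<^sup>2 * V n / 2) *
          exp ((\<theta> + \<mu>) * y - (\<theta> + \<mu>)\<^sup>2 * (\<sigma> n)\<^sup>2 / 2) =
          exp (- \<rho>) * exp ((\<theta> + \<mu>) * S - (\<theta> + \<mu>)\<^sup>2 * V (Suc n) / 2)"
        unfolding VS S_def by (simp add: mult_exp_exp algebra_simps add_divide_distrib)
      show ?thesis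
      proof (cases "S - \<theta> * V (Suc n) \<ge> r")
        case True
        \<comment> \<open>At a first crossing the two exponents differ by \<open>\<mu> * (S -
          \<theta> * V (Suc n)) - \<mu>\<^sup>2 * V (Suc n) / 2\<close>, which is at least \<rho>.
          So switching to the \<theta>-branch can only lower the integrand.\<close>
        have "\<mu> * r \<le> \<mu> * (S - \<theta> * V (Suc n))" using True \<open>\<mu> \<ge> 0\<close> by (rule mult_left_mono)
        with Suc.prems have "\<theta> * S - \<theta>\<^sup>2 * V (Suc n) / 2 \<le>
            - \<rho> + ((\<theta> + \<mu>) * S - (\<theta> + \<mu>)\<^sup>2 * V (Suc n) / 2)"
          by (simp add: power2_eq_square algebra_simps add_divide_distrib)
        then have "exp (\<theta> * S - \<theta>\<^sup>2 * V (Suc n) / 2) \<le>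
            exp (- \<rho>) * exp ((\<theta> + \<mu>) * S - (\<theta> + \<mu>)\<^sup>2 * V (Suc n) / 2)"
          by (simp add: mult_exp_exp)
        then show ?thesis unfolding g_def S
          by (simp add: rhs flip: ennreal_mult)
      next
        case new: False
        have neg: "\<not> (\<exists>k\<le>Suc n. (\<Sum>i<k. (x(n := y)) i) - \<theta> * V k \<ge> r)"
        proof clarify
          fix k assume k: "k \<le> Suc n" "r \<le> (\<Sum>i<k. (x(n := y)) i) - \<theta> * V k"
          show False
          proof (cases "k = Suc n")
            case True with k new S show False by simp
          next
            case kn: False
            then have "(\<Sum>i<k. (x(n := y)) i) = (\<Sum>i<k. x i)" using k by (intro sum.cong) auto
            with False k kn show False by auto
          qed
        qed
        show ?thesis
          by (simp only: g_def if_not_P[OF neg] S) (simp add: rhs flip: ennreal_mult)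
      qed
    qed
    then have "(\<integral>\<^sup>+y. g (Suc n) (x(n := y)) \<partial>N n) \<le>
        (\<integral>\<^sup>+y. ennreal (exp (- \<rho>) * exp ((\<theta> + \<mu>) * (\<Sum>i<n. x i) - (\<theta> + \<mu>)\<^sup>2 * V n / 2)) *
        ennreal (exp ((\<theta> + \<mu>) * y - (\<theta> + \<mu>)\<^sup>2 * (\<sigma> n)\<^sup>2 / 2)) \<partial>N n)"
      by (intro nn_integral_mono)
    also have "\<dots> = g n x"
      by (subst nn_integral_cmult)
         (simp_all add: N_def nn_integral_normal_exp_tilt[OF pos] g_def if_not_P[OF False])
    finally show ?thesis .
  qed
  have "(\<integral>\<^sup>+x. g (Suc n) x \<partial>Pi\<^sub>M {..<Suc n} N) = (\<integral>\<^sup>+x. (\<integral>\<^sup>+y. g (Suc n) (x(n := y)) \<partial>N n) \<partial>Pi\<^sub>M {..<n} N)"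
    unfolding lessThan_Suc using g_meas[of "Suc n"]
    by (intro product_nn_integral_insert) (auto simp: lessThan_Suc)
  also have "\<dots> \<le> (\<integral>\<^sup>+x. g n x \<partial>Pi\<^sub>M {..<n} N)" by (intro nn_integral_mono step)
  also have "\<dots> \<le> ennreal (exp (- \<rho>))" using Suc.IH[OF le] unfolding g_def N_def .
  finally show ?case unfolding g_def N_def .
qed

text \<open>For \<open>\<theta> \<noteq> 0\<close> the sums are recentred around their mean under the measure with density
  proportional to \<open>exp (\<theta> * (\<Sum>i<n. Y i))\<close>, where they are a martingale again.\<close>

lemma (in prob_space) indep_normal_tilted_maximal:
  fixes Y :: "nat \<Rightarrow> 'a \<Rightarrow> real" and \<sigma> :: "nat \<Rightarrow> real"
  defines "V k \<equiv> \<Sum>i<k. (\<sigma> i)\<^sup>2"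
  assumes ind: "indep_vars (\<lambda>_. borel) Y {..<n}" and pos: "\<And>i. \<sigma> i > 0"
    and dist: "\<And>i. i < n \<Longrightarrow> distributed M lborel (Y i) (normal_density 0 (\<sigma> i))"
    and "\<mu> \<ge> 0"
  shows "(\<integral>\<^sup>+\<omega>. ennreal (exp (\<theta> * (\<Sum>i<n. Y i \<omega>) - \<theta>\<^sup>2 * V n / 2)) *
      indicator {\<omega>. \<exists>k\<le>n. (\<Sum>i<k. Y i \<omega>) - \<theta> * V k \<ge> r} \<omega> \<partial>M) \<le> ennreal (exp (\<mu>\<^sup>2 * V n / 2 - \<mu> * r))"
\<comment> \<open>The empty family is treated apart: the identification of the joint law with a
  product measure is applied to a nonempty index set.\<close>
proof (cases "n = 0")
  case True
  then show ?thesis using \<open>\<mu> \<ge> 0\<close>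
    by (auto simp: V_def indicator_def emeasure_space_1 mult_nonneg_nonpos split: if_splits)
next
  case False
  \<comment> \<open>The largest value that the hypothesis of
    \<open>PiM_normal_tilted_maximal\<close> allows. Discarding the branch without a crossing there
    leaves the integral to be bounded.\<close>
  define \<rho> where "\<rho> = \<mu> * r - \<mu>\<^sup>2 * V n / 2"
  have rv[measurable]: "Y i \<in> borel_measurable M" if "i < n" for i
    using dist[OF that] by (auto simp: distributed_def)
  define N where "N i = density lborel (normal_density 0 (\<sigma> i))" for i
  define g where "g x = ennreal (if \<exists>k\<le>n. (\<Sum>i<k. x i) - \<theta> * V k \<ge> r
      then exp (\<theta> * (\<Sum>i<n. x i) - \<theta>\<^sup>2 * V n / 2)
      else exp (- \<rho>) * exp ((\<theta> + \<mu>) * (\<Sum>i<n. x i) - (\<theta> + \<mu>)\<^sup>2 * V n / 2))" for x :: "nat \<Rightarrow> real"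
  have N: "distr M borel (Y i) = N i" if "i < n" for i
  proof -
    have "distr M borel (Y i) = distr M lborel (Y i)" by (intro distr_cong) auto
    then show ?thesis using dist[OF that] by (simp add: distributed_def N_def)
  qed
  have D: "distr M (\<Pi>\<^sub>M i\<in>{..<n}. borel) (\<lambda>x. \<lambda>i\<in>{..<n}. Y i x) = Pi\<^sub>M {..<n} N"
  proof -
    have "distr M (\<Pi>\<^sub>M i\<in>{..<n}. borel) (\<lambda>x. \<lambda>i\<in>{..<n}. Y i x) = (\<Pi>\<^sub>M i\<in>{..<n}. distr M borel (Y i))"
      using ind False by (subst indep_vars_iff_distr_eq_PiM'[symmetric]) auto
    also have "\<dots> = Pi\<^sub>M {..<n} N" using N by (intro PiM_cong) auto
    finally show ?thesis .
  qed
  have g_meas: "g \<in> borel_measurable (\<Pi>\<^sub>M i\<in>{..<n}. borel)"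
  proof -
    define F where "F x \<longleftrightarrow> (\<exists>k\<le>n. (\<Sum>i<k. x i) - \<theta> * V k \<ge> r)" for x :: "nat \<Rightarrow> real"
    have [measurable]: "Measurable.pred (\<Pi>\<^sub>M i\<in>{..<n}. borel) F"
      "(\<lambda>x. \<Sum>i<n. x i :: real) \<in> borel_measurable (\<Pi>\<^sub>M i\<in>{..<n}. borel)"
      unfolding F_def[abs_def]
      by (rule measurable_PiM_crossing, simp) (rule measurable_PiM_sum, simp_all)
    show ?thesis unfolding g_def[abs_def] F_def[symmetric] by measurable
  qed
  have "(\<integral>\<^sup>+\<omega>. ennreal (exp (\<theta> * (\<Sum>i<n. Y i \<omega>) - \<theta>\<^sup>2 * V n / 2)) *
      indicator {\<omega>. \<exists>k\<le>n. (\<Sum>i<k. Y i \<omega>) - \<theta> * V k \<ge> r} \<omega> \<partial>M) \<le>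
      (\<integral>\<^sup>+\<omega>. g (\<lambda>i\<in>{..<n}. Y i \<omega>) \<partial>M)"
  proof (rule nn_integral_mono)
    fix \<omega>
    have "(\<Sum>i<k. (\<lambda>i\<in>{..<n}. Y i \<omega>) i) = (\<Sum>i<k. Y i \<omega>)" if "k \<le> n" for k
      using that by (intro sum.cong) auto
    then show "ennreal (exp (\<theta> * (\<Sum>i<n. Y i \<omega>) - \<theta>\<^sup>2 * V n / 2)) *
      indicator {\<omega>. \<exists>k\<le>n. (\<Sum>i<k. Y i \<omega>) - \<theta> * V k \<ge> r} \<omega> \<le> g (\<lambda>i\<in>{..<n}. Y i \<omega>)"
      by (auto simp: g_def indicator_def)
  qed
  also have "\<dots> = (\<integral>\<^sup>+x. g x \<partial>Pi\<^sub>M {..<n} N)"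
    unfolding D[symmetric] using g_meas by (subst nn_integral_distr) auto
  also have "\<dots> \<le> ennreal (exp (- \<rho>))"
    unfolding g_def N_def V_def using pos \<open>\<mu> \<ge> 0\<close>
    by (intro PiM_normal_tilted_maximal) (simp_all add: \<rho>_def V_def)
  finally show ?thesis by (simp add: \<rho>_def)
qed

subsection \<open>Pathwise analysis of the reflected equation\<close>

text \<open>The pathwise value of \<open>g 0 + \<integral>\<^sub>0\<^sup>t e\<^bsup>\<gamma>s\<^esup> dg(s)\<close> after integration by parts, which makes sense for
  every continuous \<open>g\<close>.\<close>

definition exp_stieltjes :: "real \<Rightarrow> (real \<Rightarrow> real) \<Rightarrow> real \<Rightarrow> real" where
  "exp_stieltjes \<gamma> g t = exp (\<gamma> * t) * g t - \<gamma> * integral {0..t} (\<lambda>s. exp (\<gamma> * s) * g s)"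

lemma exp_stieltjes_0 [simp]: "exp_stieltjes \<gamma> g 0 = g 0"
  by (simp add: exp_stieltjes_def)

text \<open>The weight \<open>\<gamma> * exp (\<gamma> * u)\<close> is the derivative of the
  exponential, so a constant bound on \<open>g\<close> integrates to that constant times the
  increment of the exponential.\<close>

lemma exp_integral_le:
  fixes g :: "real \<Rightarrow> real"
  assumes "\<gamma> > 0" "s \<le> t" "continuous_on {s..t} g" "\<And>u. u \<in> {s..t} \<Longrightarrow> g u \<le> c"
  shows "\<gamma> * integral {s..t} (\<lambda>u. exp (\<gamma> * u) * g u) \<le> c * (exp (\<gamma> * t) - exp (\<gamma> * s))"
proof -
  have 1: "((\<lambda>u. \<gamma> * c * exp (\<gamma> * u)) has_integral c * exp (\<gamma> * t) - c * exp (\<gamma> * s)) {s..t}"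
    using assms(2) by (intro fundamental_theorem_of_calculus)
      (auto intro!: derivative_eq_intros simp flip: has_real_derivative_iff_has_vector_derivative)
  have 2: "((\<lambda>u. \<gamma> * (exp (\<gamma> * u) * g u)) has_integral \<gamma> * integral {s..t} (\<lambda>u. exp (\<gamma> * u) * g u)) {s..t}"
    using assms by (intro has_integral_mult_right integrable_integral integrable_continuous_real continuous_intros)
  have "\<gamma> * integral {s..t} (\<lambda>u. exp (\<gamma> * u) * g u) \<le> c * exp (\<gamma> * t) - c * exp (\<gamma> * s)"
    using assms(1,4) by (intro has_integral_le[OF 2 1]) (simp add: mult_left_mono mult.commute)
  then show ?thesis by (simp add: algebra_simps)
qed

lemma exp_integral_ge:
  fixes g :: "real \<Rightarrow> real"
  assumes "\<gamma> > 0" "s \<le> t" "continuous_on {s..t} g" "\<And>u. u \<in> {s..t} \<Longrightarrow> c \<le> g u"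
  shows "c * (exp (\<gamma> * t) - exp (\<gamma> * s)) \<le> \<gamma> * integral {s..t} (\<lambda>u. exp (\<gamma> * u) * g u)"
  using exp_integral_le[of \<gamma> s t "\<lambda>u. - g u" "- c"] assms
  by (simp add: continuous_on_minus algebra_simps)

lemma exp_stieltjes_diff:
  assumes "0 \<le> s" "s \<le> t" "continuous_on {0..t} g"
  shows "exp_stieltjes \<gamma> g t - exp_stieltjes \<gamma> g s =
    exp (\<gamma> * t) * g t - exp (\<gamma> * s) * g s - \<gamma> * integral {s..t} (\<lambda>u. exp (\<gamma> * u) * g u)"
proof -
  have "integral {0..s} (\<lambda>u. exp (\<gamma> * u) * g u) + integral {s..t} (\<lambda>u. exp (\<gamma> * u) * g u) =
      integral {0..t} (\<lambda>u. exp (\<gamma> * u) * g u)"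
    using assms by (intro Henstock_Kurzweil_Integration.integral_combine integrable_continuous_real continuous_intros)
  then show ?thesis unfolding exp_stieltjes_def by (simp add: algebra_simps flip: distrib_left)
qed

text \<open>Replacing \<open>g\<close> by its end value inside the integral leaves an increment of
  at least \<open>exp (\<gamma> * s) * (g t - g s)\<close>. It serves for the nondecreasing
  controls.\<close>

lemma exp_stieltjes_mono:
  assumes "\<gamma> > 0" "0 \<le> s" "s \<le> t" "continuous_on {0..t} g" "\<And>u. u \<in> {s..t} \<Longrightarrow> g u \<le> g t"
  shows "exp_stieltjes \<gamma> g s \<le> exp_stieltjes \<gamma> g t"
proof -
  have "\<gamma> * integral {s..t} (\<lambda>u. exp (\<gamma> * u) * g u) \<le> g t * (exp (\<gamma> * t) - exp (\<gamma> * s))"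
    using assms by (intro exp_integral_le) (auto intro: continuous_on_subset)
  moreover have "exp (\<gamma> * s) * g s \<le> exp (\<gamma> * s) * g t"
    using assms by (intro mult_left_mono) auto
  ultimately show ?thesis
    using exp_stieltjes_diff[OF assms(2-4), of \<gamma>] by (simp only: algebra_simps)
qed

lemma exp_stieltjes_const:
  assumes "0 \<le> s" "s \<le> t" "\<gamma> > 0" "continuous_on {0..t} g" "\<And>u. u \<in> {s..t} \<Longrightarrow> g u = g t"
  shows "exp_stieltjes \<gamma> g t = exp_stieltjes \<gamma> g s"
proof -
  have "integral {s..t} (\<lambda>u. exp (\<gamma> * u) * g u) = integral {s..t} (\<lambda>u. exp (\<gamma> * u) * g t)"
    by (intro integral_cong arg_cong2[where f = "(*)"] refl assms(5))
  moreover have "\<gamma> * integral {s..t} (\<lambda>u. exp (\<gamma> * u) * g t) = g t * (exp (\<gamma> * t) - exp (\<gamma> * s))"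
    using exp_integral_le[of \<gamma> s t "\<lambda>_. g t" "g t"] exp_integral_ge[of \<gamma> s t "\<lambda>_. g t" "g t"] assms(1-3)
    by (intro antisym) auto
  ultimately show ?thesis
    using exp_stieltjes_diff[OF assms(1,2,4), of \<gamma>] assms(5)[of s] assms(1,2) by (simp add: algebra_simps)
qed

lemma exp_stieltjes_lin:
  assumes "continuous_on {0..t} v" "continuous_on {0..t} l" "continuous_on {0..t} u"
  shows "exp_stieltjes \<gamma> (\<lambda>s. v s + l s - u s) t =
    exp_stieltjes \<gamma> v t + exp_stieltjes \<gamma> l t - exp_stieltjes \<gamma> u t"
proof -
  have "((\<lambda>s. exp (\<gamma> * s) * v s + exp (\<gamma> * s) * l s - exp (\<gamma> * s) * u s) has_integral
      integral {0..t} (\<lambda>s. exp (\<gamma> * s) * v s) + integral {0..t} (\<lambda>s. exp (\<gamma> * s) * l s)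
      - integral {0..t} (\<lambda>s. exp (\<gamma> * s) * u s)) {0..t}"
    using assms by (intro has_integral_add has_integral_diff integrable_integral
      integrable_continuous_real continuous_intros)
  then have eq: "integral {0..t} (\<lambda>s. exp (\<gamma> * s) * (v s + l s - u s)) =
      integral {0..t} (\<lambda>s. exp (\<gamma> * s) * v s) + integral {0..t} (\<lambda>s. exp (\<gamma> * s) * l s)
      - integral {0..t} (\<lambda>s. exp (\<gamma> * s) * u s)"
    by (intro integral_unique) (simp add: algebra_simps)
  show ?thesis unfolding exp_stieltjes_def eq by (simp add: algebra_simps)
qed

lemma exp_stieltjes_cmult: "exp_stieltjes \<gamma> (\<lambda>s. \<beta> * w s) t = \<beta> * exp_stieltjes \<gamma> w t"
proof -
  have "integral {0..t} (\<lambda>s. exp (\<gamma> * s) * (\<beta> * w s)) = \<beta> * integral {0..t} (\<lambda>s. exp (\<gamma> * s) * w s)"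
    by (subst integral_mult_right[symmetric]) (simp add: ac_simps)
  then show ?thesis by (simp add: exp_stieltjes_def algebra_simps)
qed

lemma continuous_on_exp_stieltjes:
  assumes "continuous_on {0..t} g"
  shows "continuous_on {0..t} (exp_stieltjes \<gamma> g)"
  unfolding exp_stieltjes_def[abs_def] using assms
  by (intro continuous_intros indefinite_integral_continuous_1 integrable_continuous_real)

text \<open>The error of one left-point summand is the oscillation of \<open>g\<close> times the
  increment of the exponential. In this form the errors telescope over a grid.\<close>

lemma exp_stieltjes_increment:
  assumes "\<gamma> > 0" "0 \<le> s" "s \<le> t" "continuous_on {0..t} g" "\<And>u. u \<in> {s..t} \<Longrightarrow> \<bar>g u - g t\<bar> \<le> \<eta>"
  shows "\<bar>exp_stieltjes \<gamma> g t - exp_stieltjes \<gamma> g s - exp (\<gamma> * s) * (g t - g s)\<bar>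
    \<le> \<eta> * (exp (\<gamma> * t) - exp (\<gamma> * s))"
proof -
  have "g u \<le> g t + \<eta>" "g t - \<eta> \<le> g u" if "u \<in> {s..t}" for u using assms(5)[OF that] by linarith+
  then have "\<gamma> * integral {s..t} (\<lambda>u. exp (\<gamma> * u) * g u) \<le> (g t + \<eta>) * (exp (\<gamma> * t) - exp (\<gamma> * s))"
    "(g t - \<eta>) * (exp (\<gamma> * t) - exp (\<gamma> * s)) \<le> \<gamma> * integral {s..t} (\<lambda>u. exp (\<gamma> * u) * g u)"
    using assms(1-4) by (intro exp_integral_le exp_integral_ge; force intro: continuous_on_subset)+
  then show ?thesis
    unfolding exp_stieltjes_diff[OF assms(2-4)] by (simp add: abs_le_iff algebra_simps)
qed

section \<open>Pathwise convergence of the weighted Riemann sums\<close>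

lemma grid_index_bounds:
  fixes \<tau> T :: real and n :: nat
  assumes "T > 0" "\<tau> \<in> {0..T}" "n > 0"
  defines "k \<equiv> nat \<lfloor>\<tau> * real n / T\<rfloor>"
  shows "real k * T / n \<le> \<tau>" "\<tau> - T / n \<le> real k * T / n" "k \<le> n"
proof -
  have "0 \<le> \<tau> * real n / T" using assms by auto
  then have k: "real k \<le> \<tau> * real n / T" "\<tau> * real n / T - 1 \<le> real k"
    unfolding k_def by linarith+
  show "real k * T / n \<le> \<tau>"
    using k(1) assms(1,3) by (simp add: field_simps)
  have "(\<tau> * real n / T - 1) * (T / n) \<le> real k * (T / n)"
    using k(2) \<open>T > 0\<close> by (intro mult_right_mono) auto
  then show "\<tau> - T / n \<le> real k * T / n"
    using assms(1,3) by (simp add: left_diff_distrib diff_divide_distrib)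
  have "\<tau> * real n / T \<le> real n" using assms(1-3) by (simp add: field_simps)
  with k show "k \<le> n" by linarith
qed

text \<open>The weight is smooth, so the left-point sums converge for each single continuous
  integrator, and the Wiener integral can be handled path by path. The upper index is that of the
  last grid point at or before \<tau>; these points tend to \<tau>, and \<open>exp_stieltjes\<close>
  is continuous.\<close>

lemma exp_stieltjes_LIMSEQ:
  assumes "\<gamma> > 0" "T > 0" "\<tau> \<in> {0..T}" and cont: "continuous_on {0..T} g"
  shows "(\<lambda>n. \<Sum>i<nat \<lfloor>\<tau> * real n / T\<rfloor>. exp (\<gamma> * (real i * T / real n)) *
      (g (real (Suc i) * T / real n) - g (real i * T / real n)))
    \<longlonglongrightarrow> exp_stieltjes \<gamma> g \<tau> - g 0"
proof -
  define t where "t n i = real i * T / real n" for n i :: nat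
  define k where "k n = nat \<lfloor>\<tau> * real n / T\<rfloor>" for n :: nat
  define S where "S n m = (\<Sum>i<m. exp (\<gamma> * t n i) * (g (t n (Suc i)) - g (t n i)))" for n m
  have k_bounds: "t n (k n) \<le> \<tau>" "\<tau> - T / n \<le> t n (k n)" "k n \<le> n" if "n > 0" for n
    using grid_index_bounds[OF assms(2,3) that] by (simp_all add: t_def k_def)
  have "(\<lambda>n. S n (k n) - (exp_stieltjes \<gamma> g (t n (k n)) - g 0)) \<longlonglongrightarrow> 0"
  proof (rule LIMSEQ_I)
    fix e :: real assume "e > 0"
    \<comment> \<open>The local errors telescope to at most
      \<open>\<eta> * exp (\<gamma> * T)\<close>, which this choice makes
      \<open>e / 2\<close>.\<close>
    define \<eta> where "\<eta> = e / 2 / exp (\<gamma> * T)"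
    have "\<eta> > 0" using \<open>e > 0\<close> by (simp add: \<eta>_def)
    have "uniformly_continuous_on {0..T} g" using cont by (intro compact_uniformly_continuous) auto
    then obtain \<delta> where "\<delta> > 0" and \<delta>: "\<And>u v. u \<in> {0..T} \<Longrightarrow> v \<in> {0..T} \<Longrightarrow> dist v u < \<delta> \<Longrightarrow> dist (g v) (g u) < \<eta>"
      using \<open>\<eta> > 0\<close> unfolding uniformly_continuous_on_def by blast
    obtain n0 :: nat where n0: "n0 > T / \<delta>" using reals_Archimedean2 by blast
    have "norm (S n (k n) - (exp_stieltjes \<gamma> g (t n (k n)) - g 0) - 0) < e" if "n \<ge> max 1 n0" for n
    proof -
      have "n > 0" using that by simp
      have "T / \<delta> < n" using n0 that by simp
      then have "T / n < \<delta>" using \<open>\<delta> > 0\<close> \<open>n > 0\<close> by (simp add: field_simps)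
      have "\<bar>exp_stieltjes \<gamma> g (t n m) - g 0 - S n m\<bar> \<le> \<eta> * (exp (\<gamma> * t n m) - 1)" if "m \<le> n" for m
        using that
      proof (induction m)
        case 0
        then show ?case by (simp add: S_def t_def)
      next
        case (Suc m)
        have t: "0 \<le> t n m" "t n m \<le> t n (Suc m)" "t n (Suc m) \<le> T" "t n (Suc m) - t n m = T / n"
          using mult_right_mono[of "real (Suc m)" "real n" T] Suc.prems \<open>n > 0\<close> \<open>T > 0\<close>
          by (auto simp: t_def field_simps)
        have "\<bar>exp_stieltjes \<gamma> g (t n (Suc m)) - exp_stieltjes \<gamma> g (t n m) -
            exp (\<gamma> * t n m) * (g (t n (Suc m)) - g (t n m))\<bar>
            \<le> \<eta> * (exp (\<gamma> * t n (Suc m)) - exp (\<gamma> * t n m))"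
        proof (rule exp_stieltjes_increment)
          fix u assume "u \<in> {t n m..t n (Suc m)}"
          then have "dist (g u) (g (t n (Suc m))) < \<eta>"
            using t \<open>T / n < \<delta>\<close> by (intro \<delta>) (auto simp: dist_real_def)
          then show "\<bar>g u - g (t n (Suc m))\<bar> \<le> \<eta>" by (simp add: dist_real_def)
        qed (use t assms in \<open>auto intro: continuous_on_subset\<close>)
        moreover have "S n (Suc m) = S n m + exp (\<gamma> * t n m) * (g (t n (Suc m)) - g (t n m))"
          by (simp add: S_def)
        ultimately show ?case using Suc.IH Suc.prems by (simp add: algebra_simps)
      qed
      from this[of "k n"] k_bounds[OF \<open>n > 0\<close>]
      have "\<bar>exp_stieltjes \<gamma> g (t n (k n)) - g 0 - S n (k n)\<bar> \<le> \<eta> * (exp (\<gamma> * t n (k n)) - 1)" by simp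
      also have "\<dots> \<le> \<eta> * exp (\<gamma> * T)"
      proof (rule mult_left_mono)
        have "t n (k n) \<le> T" using k_bounds(1)[OF \<open>n > 0\<close>] assms(3) by simp
        then have "exp (\<gamma> * t n (k n)) \<le> exp (\<gamma> * T)" using \<open>\<gamma> > 0\<close> by simp
        then show "exp (\<gamma> * t n (k n)) - 1 \<le> exp (\<gamma> * T)" by linarith
      qed (use \<open>\<eta> > 0\<close> in simp)
      also have "\<dots> = e / 2" by (simp add: \<eta>_def)
      finally show ?thesis using \<open>e > 0\<close> by (simp add: abs_minus_commute algebra_simps)
    qed
    then show "\<exists>n0. \<forall>n\<ge>n0. norm (S n (k n) - (exp_stieltjes \<gamma> g (t n (k n)) - g 0) - 0) < e" by blast
  qed
  moreover have "(\<lambda>n. exp_stieltjes \<gamma> g (t n (k n))) \<longlonglongrightarrow> exp_stieltjes \<gamma> g \<tau>"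
  proof (rule continuous_on_tendsto_compose[OF continuous_on_exp_stieltjes[OF cont]])
    have "(\<lambda>n. T / real n) \<longlonglongrightarrow> 0" by (rule lim_const_over_n)
    then have "(\<lambda>n. \<tau> - T / real n) \<longlonglongrightarrow> \<tau>" by (auto intro!: tendsto_eq_intros)
    then show "(\<lambda>n. t n (k n)) \<longlonglongrightarrow> \<tau>"
      by (rule tendsto_sandwich[rotated 2, OF _ tendsto_const])
         (use k_bounds in \<open>auto intro!: eventually_sequentiallyI[of 1]\<close>)
    show "\<forall>\<^sub>F n in sequentially. t n (k n) \<in> {0..T}"
    proof (rule eventually_sequentiallyI[of 1])
      fix n :: nat assume "1 \<le> n"
      then show "t n (k n) \<in> {0..T}" using k_bounds(1)[of n] assms by (auto simp: t_def)
    qed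
  qed (use assms in auto)
  ultimately have "(\<lambda>n. S n (k n) - (exp_stieltjes \<gamma> g (t n (k n)) - g 0) +
      (exp_stieltjes \<gamma> g (t n (k n)) - g 0)) \<longlonglongrightarrow> 0 + (exp_stieltjes \<gamma> g \<tau> - g 0)"
    by (intro tendsto_add tendsto_diff tendsto_const)
  then show ?thesis by (simp add: S_def t_def k_def)
qed

text \<open>A geometric sum with ratio \<open>exp (2 * \<gamma> * T / n)\<close>, cleared of its
  denominator.\<close>

lemma exp_variance_sum:
  assumes "T \<ge> 0" "n > 0"
  shows "(\<Sum>i<k. (exp (\<gamma> * (real i * T / real n)) * sqrt (T / n))\<^sup>2) * (exp (2 * \<gamma> * T / n) - 1)
    = (exp (2 * \<gamma> * (real k * T / real n)) - 1) * (T / n)"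
proof (induction k)
  case (Suc k)
  have 1: "exp (2 * \<gamma> * (real (Suc k) * T / real n)) = exp (2 * \<gamma> * (real k * T / real n)) * exp (2 * \<gamma> * T / n)"
    using assms by (simp add: mult_exp_exp field_simps)
  have 2: "(exp (\<gamma> * (real k * T / real n)) * sqrt (T / n))\<^sup>2 = exp (2 * \<gamma> * (real k * T / real n)) * (T / n)"
    using assms by (simp add: power_mult_distrib algebra_simps flip: exp_double)
  \<comment> \<open>The induction step as an identity between real unknowns, which keeps the
    exponentials opaque.\<close>
  have 3: "(s + e * h) * (p - 1) = (e * p - 1) * h" if "s * (p - 1) = (e - 1) * h" for s e h p :: real
    using that by (simp add: algebra_simps)
  show ?case unfolding sum.lessThan_Suc 1 2 by (rule 3[OF Suc.IH])
qed simp

text \<open>The path \<open>z\<close> is as rough as \<open>g\<close>, but its drift integral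
  \<open>Q\<close> is differentiable. The function \<open>D\<close> collects differentiable terms
  only, and by the equation its derivative vanishes, so it keeps its initial value 0.\<close>

lemma variation_of_constants:
  assumes "\<gamma> \<noteq> 0" "T \<ge> 0" and z: "continuous_on {0..T} z" and g: "continuous_on {0..T} g"
    and eq: "\<And>t. t \<in> {0..T} \<Longrightarrow> z t = x + (LBINT s:{0..t}. \<alpha> - \<gamma> * z s) + g t"
  shows "exp (\<gamma> * T) * z T = x + \<alpha> / \<gamma> * (exp (\<gamma> * T) - 1) + exp_stieltjes \<gamma> g T"
proof -
  define Q where "Q t = integral {0..t} (\<lambda>s. \<alpha> - \<gamma> * z s)" for t
  have zQ: "z t = x + Q t + g t" if "t \<in> {0..T}" for t
  proof -
    have "continuous_on {0..t} z" using z that by (auto intro: continuous_on_subset)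
    then have "set_integrable lborel {0..t} (\<lambda>s. \<alpha> - \<gamma> * z s)"
      by (intro borel_integrable_atLeastAtMost' continuous_intros)
    then show ?thesis using eq[OF that] by (simp add: Q_def set_borel_integral_eq_integral)
  qed
  define D where "D t = exp (\<gamma> * t) * Q t + \<gamma> * integral {0..t} (\<lambda>s. exp (\<gamma> * s) * g s)
    - (\<alpha> / \<gamma> - x) * (exp (\<gamma> * t) - 1)" for t
  have "(D has_field_derivative 0) (at t within {0..T})" if t: "t \<in> {0..T}" for t
  proof -
    have 1: "(Q has_real_derivative \<alpha> - \<gamma> * z t) (at t within {0..T})"
      unfolding Q_def[abs_def] using z t
      by (intro integral_has_real_derivative continuous_intros)
    have 2: "((\<lambda>t. integral {0..t} (\<lambda>s. exp (\<gamma> * s) * g s)) has_real_derivative exp (\<gamma> * t) * g t)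
        (at t within {0..T})"
      using g t by (intro integral_has_real_derivative continuous_intros)
    have "exp (\<gamma> * t) * \<gamma> * Q t + exp (\<gamma> * t) * (\<alpha> - \<gamma> * z t) + \<gamma> * (exp (\<gamma> * t) * g t)
        - (\<alpha> / \<gamma> - x) * (exp (\<gamma> * t) * \<gamma>) = 0"
      using \<open>\<gamma> \<noteq> 0\<close> by (simp add: zQ[OF t] algebra_simps)
    then show ?thesis unfolding D_def[abs_def]
      by (auto intro!: derivative_eq_intros 1 2) (simp only: ac_simps)
  qed
  then obtain c where "\<And>t. t \<in> {0..T} \<Longrightarrow> D t = c"
    using has_field_derivative_zero_constant[of "{0..T}" D] by (auto simp: convex_real_interval)
  from this[of 0] this[of T] have "D T = 0" using \<open>T \<ge> 0\<close> by (simp add: D_def Q_def)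
  then show ?thesis using zQ[of T] \<open>T \<ge> 0\<close> unfolding D_def exp_stieltjes_def
    by (simp add: algebra_simps)
qed

text \<open>The half-open interval \<open>{s<..t}\<close> lies in the null set, and its Stieltjes
  mass is \<open>l t - l s\<close>. Leaving out \<open>s\<close> lets \<open>s\<close> be a time of
  contact with the barrier, such as a last visit.\<close>

lemma stieltjes_flat:
  assumes mono: "mono_on {0..} l" and cont: "continuous_on {0..} l" and "0 \<le> s" "s \<le> t"
    and null: "(\<integral>\<^sup>+u\<in>{0..t}. indicator A u \<partial>stieltjes l) = 0" and sub: "{s<..t} \<subseteq> A"
    and u: "u \<in> {s..t}"
  shows "l u = l t"
proof -
  \<comment> \<open>The constant continuation to the left of 0, as in \<open>stieltjes\<close>: it
    gives a nondecreasing continuous function on the whole line, as the formula for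
    \<open>interval_measure\<close> requires.\<close>
  define F where "F r = l (max 0 r)" for r
  have contF: "continuous_on UNIV F" unfolding F_def
    by (rule continuous_on_compose2[OF cont]) (auto intro!: continuous_intros)
  have "emeasure (interval_measure F) {s<..t} = ennreal (F t - F s)"
  proof (rule emeasure_interval_measure_Ioc)
    fix x y :: real assume "x \<le> y"
    then show "F x \<le> F y" unfolding F_def by (intro mono_onD[OF mono]) auto
  next
    fix a show "continuous (at_right a) F"
      using contF by (simp add: continuous_on_eq_continuous_at continuous_at_imp_continuous_at_within)
  qed fact
  then have "ennreal (F t - F s) = emeasure (interval_measure F) {s<..t}" ..
  also have "emeasure (interval_measure F) {s<..t} = (\<integral>\<^sup>+u. indicator {s<..t} u \<partial>stieltjes l)"
    by (simp add: stieltjes_def F_def[abs_def])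
  also have "\<dots> \<le> (\<integral>\<^sup>+u\<in>{0..t}. indicator A u \<partial>stieltjes l)"
    using sub \<open>0 \<le> s\<close> by (intro nn_integral_mono) (auto simp: indicator_def)
  finally have "F t \<le> F s" unfolding null by (simp add: ennreal_eq_0_iff)
  then have "l t \<le> l s" using assms by (simp add: F_def)
  moreover have "l s \<le> l u" "l u \<le> l t" using u assms(3) by (auto intro!: mono_onD[OF mono])
  ultimately show ?thesis by simp
qed

text \<open>The set where \<open>f\<close> is nonnegative is compact and nonempty, so it has a
  greatest element. This produces the last visit to 0 and the last time at which a comparison still
  holds.\<close>

lemma last_nonneg_time:
  fixes f :: "real \<Rightarrow> real"
  assumes "continuous_on {a..b} f" "t0 \<in> {a..b}" "f t0 \<ge> 0"
  obtains \<tau> where "\<tau> \<in> {a..b}" "f \<tau> \<ge> 0" "\<And>t. t \<in> {\<tau><..b} \<Longrightarrow> f t < 0"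
proof -
  define S where "S = {t \<in> {a..b}. 0 \<le> f t}"
  have "closed S" unfolding S_def
    using continuous_closed_preimage[OF assms(1), of "{0..}"] by (simp add: vimage_def Int_def)
  moreover have "bounded S" by (rule bounded_subset[of "{a..b}"]) (auto simp: S_def)
  ultimately have "compact S" by (simp add: compact_eq_bounded_closed)
  moreover have "S \<noteq> {}" using assms by (auto simp: S_def)
  ultimately obtain \<tau> where \<tau>: "\<tau> \<in> S" "\<And>t. t \<in> S \<Longrightarrow> t \<le> \<tau>"
    using compact_attains_sup[of S] by metis
  show thesis
  proof (rule that[of \<tau>])
    show "\<tau> \<in> {a..b}" "f \<tau> \<ge> 0" using \<tau>(1) by (auto simp: S_def)
    fix t assume t: "t \<in> {\<tau><..b}"
    show "f t < 0"
    proof (rule ccontr)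
      assume "\<not> f t < 0"
      then have "t \<in> S" using t \<tau>(1) by (auto simp: S_def)
      with \<tau>(2) t show False by force
    qed
  qed
qed

section \<open>Controls, last visits and comparison for a doubly reflected path\<close>

context
  fixes \<alpha> \<gamma> d x :: real and v z l u :: "real \<Rightarrow> real"
  assumes refl: "doubly_reflected_path \<alpha> \<gamma> d x v z l u"
    and v: "continuous_on {0..} v" and "\<gamma> > 0"
begin

lemma reflected_continuous:
  "continuous_on {0..} z" "continuous_on {0..} l" "continuous_on {0..} u"
  using refl by (auto simp: doubly_reflected_path_def regulated_path_def)

lemma reflected_basics:
  "mono_on {0..} l" "mono_on {0..} u" "l 0 = 0" "u 0 = 0"
  "t \<ge> 0 \<Longrightarrow> 0 \<le> z t"
  "t > 0 \<Longrightarrow> (\<integral>\<^sup>+s\<in>{0..t}. indicator {s. z s > 0} s \<partial>stieltjes l) = 0"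
  "t > 0 \<Longrightarrow> (\<integral>\<^sup>+s\<in>{0..t}. indicator {s. z s < d} s \<partial>stieltjes u) = 0"
proof -
  have R: "regulated_path \<alpha> \<gamma> d x v z l u"
    using refl unfolding doubly_reflected_path_def by (rule conjunct1)
  then show "mono_on {0..} l" "mono_on {0..} u" "l 0 = 0" "u 0 = 0"
    unfolding regulated_path_def by simp_all
  show "t \<ge> 0 \<Longrightarrow> 0 \<le> z t"
    using R unfolding regulated_path_def atLeastAtMost_iff by blast
  note N = refl[unfolded doubly_reflected_path_def, THEN conjunct2, THEN conjunct2]
  show "t > 0 \<Longrightarrow> (\<integral>\<^sup>+s\<in>{0..t}. indicator {s. z s > 0} s \<partial>stieltjes l) = 0"
    using N[THEN conjunct1] by (elim allE impE)
  show "t > 0 \<Longrightarrow> (\<integral>\<^sup>+s\<in>{0..t}. indicator {s. z s < d} s \<partial>stieltjes u) = 0"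
    using N[THEN conjunct2] by (elim allE impE)
qed

lemma reflected_transform:
  assumes "t \<ge> 0"
  shows "exp (\<gamma> * t) * z t = x + \<alpha> / \<gamma> * (exp (\<gamma> * t) - 1) +
    exp_stieltjes \<gamma> v t + exp_stieltjes \<gamma> l t - exp_stieltjes \<gamma> u t"
proof -
  note c = continuous_on_subset[OF v, of "{0..t}"] reflected_continuous[THEN continuous_on_subset, of "{0..t}"]
  have "exp (\<gamma> * t) * z t = x + \<alpha> / \<gamma> * (exp (\<gamma> * t) - 1) + exp_stieltjes \<gamma> (\<lambda>s. v s + l s - u s) t"
  proof (rule variation_of_constants)
    fix s assume "s \<in> {0..t}"
    then show "z s = x + (LBINT r:{0..s}. \<alpha> - \<gamma> * z r) + (v s + l s - u s)"
      using refl by (simp add: doubly_reflected_path_def regulated_path_def)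
  qed (use \<open>\<gamma> > 0\<close> assms c in \<open>auto intro!: continuous_intros\<close>)
  then show ?thesis using c by (simp add: exp_stieltjes_lin)
qed

lemma controls_mono:
  assumes "0 \<le> s" "s \<le> t"
  shows "exp_stieltjes \<gamma> l s \<le> exp_stieltjes \<gamma> l t" "exp_stieltjes \<gamma> u s \<le> exp_stieltjes \<gamma> u t"
proof -
  note mono = reflected_basics(1,2)[THEN mono_onD]
  show "exp_stieltjes \<gamma> l s \<le> exp_stieltjes \<gamma> l t"
    using assms \<open>\<gamma> > 0\<close> reflected_continuous(2)
    by (intro exp_stieltjes_mono mono(1)) (auto intro: continuous_on_subset)
  show "exp_stieltjes \<gamma> u s \<le> exp_stieltjes \<gamma> u t"
    using assms \<open>\<gamma> > 0\<close> reflected_continuous(3)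
    by (intro exp_stieltjes_mono mono(2)) (auto intro: continuous_on_subset)
qed

lemma lower_control_flat:
  assumes "0 \<le> s" "s \<le> t" "\<And>r. r \<in> {s<..t} \<Longrightarrow> z r > 0"
  shows "exp_stieltjes \<gamma> l t = exp_stieltjes \<gamma> l s"
proof (cases "t = s")
  case False
  then have "t > 0" using assms by simp
  show ?thesis
  proof (rule exp_stieltjes_const)
    fix r assume "r \<in> {s..t}"
    then show "l r = l t"
      using assms
      by (intro stieltjes_flat[OF reflected_basics(1) reflected_continuous(2) _ _ reflected_basics(6)[OF \<open>t > 0\<close>], of s]) auto
  qed (use assms \<open>\<gamma> > 0\<close> reflected_continuous in \<open>auto intro: continuous_on_subset\<close>)
qed simp

lemma upper_control_flat:
  assumes "0 \<le> s" "s \<le> t" "\<And>r. r \<in> {s<..t} \<Longrightarrow> z r < d"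
  shows "exp_stieltjes \<gamma> u t = exp_stieltjes \<gamma> u s"
proof (cases "t = s")
  case False
  then have "t > 0" using assms by simp
  show ?thesis
  proof (rule exp_stieltjes_const)
    fix r assume "r \<in> {s..t}"
    then show "u r = u t"
      using assms
      by (intro stieltjes_flat[OF reflected_basics(2) reflected_continuous(3) _ _ reflected_basics(7)[OF \<open>t > 0\<close>], of s]) auto
  qed (use assms \<open>\<gamma> > 0\<close> reflected_continuous in \<open>auto intro: continuous_on_subset\<close>)
qed simp

text \<open>After its last zero \<open>\<tau>\<close> the path is driven by the noise alone, and the drift contributes at
  most what it contributes on all of \<open>[0, T]\<close> starting from \<open>x \<ge> 0\<close>.\<close>

lemma reflected_large_imp_noise_large:
  assumes "\<alpha> > 0" "x \<ge> 0" "T > 0" "v 0 = 0" "z T \<ge> b"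
  shows "\<exists>\<tau>\<in>{0..T}. exp_stieltjes \<gamma> v T - exp_stieltjes \<gamma> v \<tau> \<ge>
    exp (\<gamma> * T) * b - x - \<alpha> / \<gamma> * (exp (\<gamma> * T) - 1)"
proof (cases "\<exists>t\<in>{0..T}. z t = 0")
  case False
  have "z r > 0" if "r \<in> {0<..T}" for r
    using reflected_basics(5)[of r] False that by (force simp: less_le)
  then have "exp_stieltjes \<gamma> l T = exp_stieltjes \<gamma> l 0"
    using \<open>T > 0\<close> by (intro lower_control_flat) auto
  moreover have "exp_stieltjes \<gamma> u 0 \<le> exp_stieltjes \<gamma> u T"
    using \<open>T > 0\<close> by (intro controls_mono) auto
  moreover have "exp (\<gamma> * T) * b \<le> exp (\<gamma> * T) * z T" using assms by simp
  ultimately show ?thesis using reflected_transform[of T] assms reflected_basics(3,4)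
    by (intro bexI[of _ 0]) auto
next
  case True
  then obtain t0 where "t0 \<in> {0..T}" "- z t0 \<ge> 0" by auto
  moreover have "continuous_on {0..T} (\<lambda>t. - z t)"
    using reflected_continuous by (auto intro!: continuous_intros elim: continuous_on_subset)
  ultimately obtain \<tau> where \<tau>: "\<tau> \<in> {0..T}" "z \<tau> \<le> 0" "\<And>t. t \<in> {\<tau><..T} \<Longrightarrow> z t > 0"
    using last_nonneg_time[of 0 T "\<lambda>t. - z t" t0] by auto
  have "z \<tau> = 0"
    using reflected_basics(5)[of \<tau>] \<tau> by simp
  have "exp_stieltjes \<gamma> l T = exp_stieltjes \<gamma> l \<tau>"
    using \<tau> by (intro lower_control_flat) auto
  moreover have "exp_stieltjes \<gamma> u \<tau> \<le> exp_stieltjes \<gamma> u T"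
    using \<tau> by (intro controls_mono) auto
  moreover have "exp (\<gamma> * T) * b \<le> exp (\<gamma> * T) * z T" using assms by simp
  moreover have "0 \<le> \<alpha> / \<gamma> * (exp (\<gamma> * \<tau>) - 1)"
    using \<tau> assms \<open>\<gamma> > 0\<close> by (intro mult_nonneg_nonneg) auto
  \<comment> \<open>Subtracting the transforms at \<open>T\<close> and \<tau> cancels
    \<open>x\<close> and the lower push, and the upper push only helps. Replacing
    \<open>exp (\<gamma> * \<tau>)\<close> by 1 and allowing for \<open>x\<close> weakens the bound
    to one independent of \<tau>.\<close>
  ultimately show ?thesis
    using reflected_transform[of T] reflected_transform[of \<tau>] assms \<tau> \<open>z \<tau> = 0\<close>
    by (intro bexI[of _ \<tau>]) auto
qed

text \<open>Whenever the unreflected path \<open>y\<close> is above \<open>z\<close>, the latter is below \<open>d\<close> and not pushed down.\<close>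

lemma unreflected_le_reflected:
  assumes "T \<ge> 0" "y0 \<le> x"
    and below: "\<And>t. t \<in> {0..T} \<Longrightarrow>
      y0 + \<alpha> / \<gamma> * (exp (\<gamma> * t) - 1) + exp_stieltjes \<gamma> v t \<le> d * exp (\<gamma> * t)"
  shows "y0 + \<alpha> / \<gamma> * (exp (\<gamma> * T) - 1) + exp_stieltjes \<gamma> v T \<le> exp (\<gamma> * T) * z T"
proof (rule ccontr)
  assume neg: "\<not> ?thesis"
  define y where "y t = y0 + \<alpha> / \<gamma> * (exp (\<gamma> * t) - 1) + exp_stieltjes \<gamma> v t" for t
  define D where "D t = exp (\<gamma> * t) * z t - y t" for t
  \<comment> \<open>Noise and drift cancel in the difference, so it moves through the controls alone
    and can decrease only through \<open>u\<close>.\<close>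
  have D: "D t = x - y0 + exp_stieltjes \<gamma> l t - exp_stieltjes \<gamma> u t" if "t \<in> {0..T}" for t
    using reflected_transform[of t] that by (simp add: D_def y_def)
  have "continuous_on {0..T} D"
    unfolding D_def[abs_def] y_def[abs_def] using v reflected_continuous
    by (intro continuous_intros continuous_on_exp_stieltjes) (auto elim: continuous_on_subset)
  moreover have "D 0 \<ge> 0"
    using D[of 0] assms(1,2) reflected_basics(3,4) by simp
  \<comment> \<open>After the last time with \<open>D\<close> nonnegative, \<open>z\<close> is below
    the unreflected path, hence below \<open>d\<close>, so \<open>u\<close> is frozen. Then
    \<open>D\<close> cannot have become negative by time \<open>T\<close>.\<close>
  ultimately obtain \<tau> where \<tau>: "\<tau> \<in> {0..T}" "D \<tau> \<ge> 0" "\<And>t. t \<in> {\<tau><..T} \<Longrightarrow> D t < 0"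
    using last_nonneg_time[of 0 T D 0] \<open>T \<ge> 0\<close> by auto
  have "z t < d" if "t \<in> {\<tau><..T}" for t
  proof -
    have "exp (\<gamma> * t) * z t < y t" "y t \<le> exp (\<gamma> * t) * d"
      using \<tau>(3)[OF that] below[of t] that \<tau>(1) by (simp_all add: D_def y_def mult.commute)
    then have "exp (\<gamma> * t) * z t < exp (\<gamma> * t) * d" by linarith
    then show ?thesis by simp
  qed
  then have "exp_stieltjes \<gamma> u T = exp_stieltjes \<gamma> u \<tau>"
    using \<tau> by (intro upper_control_flat) auto
  moreover have "exp_stieltjes \<gamma> l \<tau> \<le> exp_stieltjes \<gamma> l T"
    using \<tau> by (intro controls_mono) auto
  ultimately have "D T \<ge> 0" using D[of T] D[of \<tau>] \<tau> by auto
  with neg show False by (simp add: D_def y_def)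
qed

end

subsection \<open>Brownian Riemann sums\<close>

text \<open>Fatou's lemma for indicators: almost every point of \<open>E\<close> lies in
  \<open>A n\<close> for all large \<open>n\<close>, where "large" may depend on the point. It
  carries bounds for Riemann sums over to their pathwise limit.\<close>

lemma (in prob_space) prob_le_eventually:
  assumes [measurable]: "E \<in> events" "\<And>n. A n \<in> events"
    and sub: "AE \<omega> in M. \<omega> \<in> E \<longrightarrow> (\<forall>\<^sub>F n in sequentially. \<omega> \<in> A n)"
    and bound: "\<forall>\<^sub>F n in sequentially. prob (A n) \<le> c n" and lim: "c \<longlonglongrightarrow> c'"
  shows "prob E \<le> c'"
proof -
  have "emeasure M E = (\<integral>\<^sup>+\<omega>. indicator E \<omega> \<partial>M)" by simp
  also have "\<dots> \<le> (\<integral>\<^sup>+\<omega>. liminf (\<lambda>n. indicator (A n) \<omega>) \<partial>M)"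
  proof (rule nn_integral_mono_AE)
    show "AE \<omega> in M. indicator E \<omega> \<le> (liminf (\<lambda>n. indicator (A n) \<omega>) :: ennreal)"
      using sub
    proof eventually_elim
      case (elim \<omega>)
      show ?case
      proof (cases "\<omega> \<in> E")
        case True
        with elim have "\<forall>\<^sub>F n in sequentially. (1::ennreal) \<le> indicator (A n) \<omega>"
          by (auto elim: eventually_mono)
        then show ?thesis using Liminf_bounded[of "1::ennreal"] True by simp
      qed simp
    qed
  qed
  also have "\<dots> \<le> liminf (\<lambda>n. \<integral>\<^sup>+\<omega>. indicator (A n) \<omega> \<partial>M)"
    by (intro nn_integral_liminf) simp
  also have "\<dots> = liminf (\<lambda>n. ennreal (prob (A n)))" by (simp add: emeasure_eq_measure)
  also have "\<dots> \<le> liminf (\<lambda>n. ennreal (c n))"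
    using bound by (intro Liminf_mono) (auto elim!: eventually_mono intro: ennreal_leI)
  also have "\<dots> = ennreal c'" by (intro lim_imp_Liminf tendsto_ennrealI lim) simp
  finally have "ennreal (prob E) \<le> ennreal c'" by (simp add: emeasure_eq_measure)
  \<comment> \<open>\<open>ennreal\<close> sends negative numbers to 0, so the return to real
    numbers uses the sign of \<open>c'\<close>.\<close>
  moreover have "c' \<ge> 0"
    by (rule tendsto_lowerbound[OF lim])
       (use bound in \<open>auto elim!: eventually_mono intro: order_trans[OF measure_nonneg]\<close>)
  ultimately show ?thesis by simp
qed

text \<open>The left-point approximation of the Wiener integral of \<open>exp (\<gamma> * s)\<close>
  against \<open>B\<close> over the first \<open>k\<close> of \<open>n\<close> equal cells of
  [0, T].\<close>

definition wiener_sum :: "(real \<Rightarrow> 'a \<Rightarrow> real) \<Rightarrow> real \<Rightarrow> real \<Rightarrow> nat \<Rightarrow> nat \<Rightarrow> 'a \<Rightarrow> real" where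
  "wiener_sum B \<gamma> T n k \<omega> = (\<Sum>i<k. exp (\<gamma> * (real i * T / real n)) *
      (B (real (Suc i) * T / real n) \<omega> - B (real i * T / real n) \<omega>))"

text \<open>\<open>exp_var \<gamma> t = \<integral>\<^sub>0\<^sup>t e\<^bsup>2\<gamma>s\<^esup> ds\<close> is the variance of \<open>\<integral>\<^sub>0\<^sup>t e\<^bsup>\<gamma>s\<^esup> dB\<^sub>s\<close>.\<close>

definition exp_var :: "real \<Rightarrow> real \<Rightarrow> real" where
  "exp_var \<gamma> t = (exp (2 * \<gamma> * t) - 1) / (2 * \<gamma>)"

definition exp_var_sum :: "real \<Rightarrow> real \<Rightarrow> nat \<Rightarrow> nat \<Rightarrow> real" where
  "exp_var_sum \<gamma> T n k = (\<Sum>i<k. (exp (\<gamma> * (real i * T / real n)) * sqrt (T / n))\<^sup>2)"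

lemma exp_var_mono:
  assumes "\<gamma> > 0" "s \<le> t"
  shows "exp_var \<gamma> s \<le> exp_var \<gamma> t"
  using assms by (simp add: exp_var_def divide_right_mono)

lemma exp_var_pos:
  assumes "\<gamma> > 0" "t > 0"
  shows "exp_var \<gamma> t > 0"
  using assms by (simp add: exp_var_def)

lemma exp_var_nonneg:
  assumes "\<gamma> > 0" "t \<ge> 0"
  shows "exp_var \<gamma> t \<ge> 0"
  using assms by (simp add: exp_var_def)

text \<open>With h = 2\<gamma>T/n, the discrete variance is the continuous one times h/(exp h - 1).
  This factor is at most 1 and tends to 1, which gives \<open>exp_var_sum_le\<close> and
  \<open>exp_var_sum_LIMSEQ\<close>.\<close>

lemma exp_var_sum_eq:
  assumes "\<gamma> > 0" "T > 0" "n > 0"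
  shows "exp_var_sum \<gamma> T n k =
    exp_var \<gamma> (real k * T / n) * (2 * \<gamma> * T / n / (exp (2 * \<gamma> * T / n) - 1))"
proof -
  have "2 * \<gamma> * T / n > 0" using assms by simp
  then have "exp (2 * \<gamma> * T / n) - 1 > 0" by simp
  moreover have "exp_var_sum \<gamma> T n k * (exp (2 * \<gamma> * T / n) - 1) =
      (exp (2 * \<gamma> * (real k * T / real n)) - 1) * (T / n)"
    unfolding exp_var_sum_def using assms by (intro exp_variance_sum) auto
  ultimately have "exp_var_sum \<gamma> T n k =
      (exp (2 * \<gamma> * (real k * T / real n)) - 1) * (T / n) / (exp (2 * \<gamma> * T / n) - 1)"
    by (metis nonzero_eq_divide_eq less_irrefl)
  then show ?thesis using assms by (simp add: exp_var_def)
qed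

lemma exp_var_sum_le:
  assumes "\<gamma> > 0" "T > 0" "n > 0"
  shows "exp_var_sum \<gamma> T n k \<le> exp_var \<gamma> (real k * T / n)"
proof -
  have "2 * \<gamma> * T / n > 0" using assms by simp
  moreover have "1 + 2 * \<gamma> * T / n \<le> exp (2 * \<gamma> * T / n)" by (rule exp_ge_add_one_self)
  ultimately have "2 * \<gamma> * T / n / (exp (2 * \<gamma> * T / n) - 1) \<le> 1"
    by (subst divide_le_eq_1_pos) linarith+
  then show ?thesis unfolding exp_var_sum_eq[OF assms]
    by (rule mult_left_le) (use exp_var_nonneg[of \<gamma> "real k * T / n"] assms in simp)
qed

lemma exp_var_sum_LIMSEQ:
  assumes "\<gamma> > 0" "T > 0"
  shows "(\<lambda>n. exp_var_sum \<gamma> T n n) \<longlonglongrightarrow> exp_var \<gamma> T"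
proof -
  define h where "h n = 2 * \<gamma> * T / real n" for n
  have "((\<lambda>y. (exp y - 1) / y) \<longlongrightarrow> 1) (at (0::real))"
    using DERIV_exp[of "0::real"] by (simp add: has_field_derivative_iff)
  moreover have "filterlim h (at 0) sequentially"
    unfolding h_def filterlim_at using assms
    by (auto intro!: lim_const_over_n eventually_sequentiallyI[of 1])
  ultimately have "(\<lambda>n. (exp (h n) - 1) / h n) \<longlonglongrightarrow> 1" by (rule filterlim_compose)
  then have "(\<lambda>n. exp_var \<gamma> T * inverse ((exp (h n) - 1) / h n)) \<longlonglongrightarrow> exp_var \<gamma> T * inverse 1"
    by (intro tendsto_intros) auto
  then have "(\<lambda>n. exp_var \<gamma> T * (h n / (exp (h n) - 1))) \<longlonglongrightarrow> exp_var \<gamma> T" by simp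
  then show ?thesis
  proof (rule Lim_transform_eventually)
    show "\<forall>\<^sub>F n in sequentially. exp_var \<gamma> T * (h n / (exp (h n) - 1)) = exp_var_sum \<gamma> T n n"
      using exp_var_sum_eq[OF assms] by (intro eventually_sequentiallyI[of 1]) (simp add: h_def)
  qed
qed

section \<open>Maximal and tail estimates for the Brownian sums\<close>

locale brownian =
  fixes M :: "'a measure" and B :: "real \<Rightarrow> 'a \<Rightarrow> real" and \<gamma> T :: real
  assumes bm: "standard_brownian_motion M B" and \<gamma>: "\<gamma> > 0" and T: "T > 0"
begin

sublocale prob_space M using bm by (simp add: standard_brownian_motion_def)

abbreviation "S \<equiv> wiener_sum B \<gamma> T"
abbreviation "Q \<equiv> exp_var \<gamma> T"

lemma Q_pos: "Q > 0" by (rule exp_var_pos[OF \<gamma> T])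

lemma measurable_S [measurable]: "S n k \<in> borel_measurable M"
proof -
  have [measurable]: "B (real i * T / real n) \<in> borel_measurable M" for i
    using bm T by (simp add: standard_brownian_motion_def)
  show ?thesis unfolding wiener_sum_def[abs_def] by measurable
qed

lemma weighted_increments:
  assumes "n > 0"
  defines "Y i \<omega> \<equiv> exp (\<gamma> * (real i * T / real n)) *
      (B (real (Suc i) * T / real n) \<omega> - B (real i * T / real n) \<omega>)"
  shows "indep_vars (\<lambda>_. borel) Y {..<n}"
    and "distributed M lborel (Y i) (normal_density 0 (exp (\<gamma> * (real i * T / real n)) * sqrt (T / n)))"
proof -
  define \<tau> where "\<tau> i = real i * T / real n" for i
  have \<tau>: "0 \<le> \<tau> i" "\<tau> i < \<tau> (Suc i)" "\<tau> (Suc i) - \<tau> i = T / n" for i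
    using assms T by (auto simp: \<tau>_def field_simps)
  have "indep_vars (\<lambda>_. borel) (\<lambda>i \<omega>. B (\<tau> (Suc i)) \<omega> - B (\<tau> i) \<omega>) {..<n}"
    using bm \<tau> unfolding standard_brownian_motion_def by blast
  then have "indep_vars (\<lambda>_. borel)
      (\<lambda>i \<omega>. exp (\<gamma> * \<tau> i) * (B (\<tau> (Suc i)) \<omega> - B (\<tau> i) \<omega>)) {..<n}"
    by (rule indep_vars_compose2) simp
  then show "indep_vars (\<lambda>_. borel) Y {..<n}" by (simp add: Y_def[abs_def] \<tau>_def)
  have "distributed M lborel (\<lambda>\<omega>. B (\<tau> (Suc i)) \<omega> - B (\<tau> i) \<omega>) (normal_density 0 (sqrt (\<tau> (Suc i) - \<tau> i)))"
    using bm \<tau> unfolding standard_brownian_motion_def by blast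
  then have "distributed M lborel (\<lambda>\<omega>. 0 + exp (\<gamma> * \<tau> i) * (B (\<tau> (Suc i)) \<omega> - B (\<tau> i) \<omega>))
      (normal_density (0 + exp (\<gamma> * \<tau> i) * 0) (\<bar>exp (\<gamma> * \<tau> i)\<bar> * sqrt (\<tau> (Suc i) - \<tau> i)))"
    using T assms by (intro normal_density_affine) (auto simp: \<tau>)
  then show "distributed M lborel (Y i) (normal_density 0 (exp (\<gamma> * (real i * T / real n)) * sqrt (T / n)))"
    unfolding \<tau> by (simp add: Y_def[abs_def] \<tau>_def)
qed

lemma weight_pos: "n > 0 \<Longrightarrow> exp (\<gamma> * (real i * T / real n)) * sqrt (T / n) > 0"
  using T by simp

text \<open>Read from the end of the interval, the differences \<open>S n n - S n k\<close> are
  partial sums of the reversed increments, which are again independent and normal. The maximal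
  inequality applies to them with \<theta> = 0.\<close>

lemma prob_backward_maximal:
  assumes "n > 0" "p \<ge> 0"
  shows "prob {\<omega> \<in> space M. \<exists>k\<le>n. S n n \<omega> - S n k \<omega> \<ge> p} \<le> exp (- p\<^sup>2 / (2 * Q))"
proof -
  define Y where "Y i \<omega> = exp (\<gamma> * (real i * T / real n)) *
      (B (real (Suc i) * T / real n) \<omega> - B (real i * T / real n) \<omega>)" for i \<omega>
  define \<sigma> where "\<sigma> i = exp (\<gamma> * (real i * T / real n)) * sqrt (T / n)" for i
  have rev: "(\<Sum>i<k. f (n - Suc i)) = sum f {..<n} - sum f {..<n - k}" if "k \<le> n" for f :: "nat \<Rightarrow> real" and k
    using that
  proof (induction k)
    case (Suc k)
    then have "n - k = Suc (n - Suc k)" by simp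
    then show ?case using Suc by simp
  qed simp
  define E where "E = {\<omega> \<in> space M. \<exists>k\<le>n. (\<Sum>i<k. Y (n - Suc i) \<omega>) \<ge> p}"
  have E_eq: "{\<omega> \<in> space M. \<exists>k\<le>n. S n n \<omega> - S n k \<omega> \<ge> p} = E"
  proof -
    have "(\<exists>k\<le>n. S n n \<omega> - S n k \<omega> \<ge> p) \<longleftrightarrow> (\<exists>k\<le>n. (\<Sum>i<k. Y (n - Suc i) \<omega>) \<ge> p)" for \<omega>
    proof -
      have *: "(\<Sum>i<k. Y (n - Suc i) \<omega>) = S n n \<omega> - S n (n - k) \<omega>" if "k \<le> n" for k
        using rev[OF that, of "\<lambda>i. Y i \<omega>"] by (simp add: wiener_sum_def Y_def)
      show ?thesis
      proof safe
        fix k assume "k \<le> n" "S n n \<omega> - S n k \<omega> \<ge> p"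
        then show "\<exists>k\<le>n. (\<Sum>i<k. Y (n - Suc i) \<omega>) \<ge> p"
          using *[of "n - k"] by (intro exI[of _ "n - k"]) simp
      next
        fix k assume "k \<le> n" "(\<Sum>i<k. Y (n - Suc i) \<omega>) \<ge> p"
        then show "\<exists>k\<le>n. S n n \<omega> - S n k \<omega> \<ge> p"
          using *[of k] by (intro exI[of _ "n - k"]) simp
      qed
    qed
    then show ?thesis by (simp add: E_def)
  qed
  have ind: "indep_vars (\<lambda>_. borel) (\<lambda>i. Y (n - Suc i)) {..<n}"
  proof -
    have "indep_vars (\<lambda>_. borel) Y {..<n}"
      unfolding Y_def[abs_def] by (rule weighted_increments(1)[OF \<open>n > 0\<close>])
    \<comment> \<open>Grouping the indices into the disjoint singletons \<open>{n - Suc i}\<close>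
      carries independence over to the reversed family.\<close>
    then have "indep_vars (\<lambda>i. PiM {n - Suc i} (\<lambda>_. borel)) (\<lambda>i \<omega>. restrict (\<lambda>j. Y j \<omega>) {n - Suc i}) {..<n}"
      by (rule indep_vars_restrict) (auto simp: disjoint_family_on_def)
    then have "indep_vars (\<lambda>_. borel) (\<lambda>i \<omega>. (\<lambda>f. f (n - Suc i)) (restrict (\<lambda>j. Y j \<omega>) {n - Suc i})) {..<n}"
      by (rule indep_vars_compose2) (rule measurable_component_singleton, simp)
    then show ?thesis by simp
  qed
  have V: "(\<Sum>i<n. (\<sigma> (n - Suc i))\<^sup>2) \<le> Q"
    using exp_var_sum_le[OF \<gamma> T \<open>n > 0\<close>, of n] \<open>n > 0\<close>
    by (subst sum.nat_diff_reindex[of "\<lambda>i. (\<sigma> i)\<^sup>2"]) (simp add: exp_var_sum_def \<sigma>_def)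
  \<comment> \<open>The minimizer of \<open>\<mu>\<^sup>2 * Q / 2 - \<mu> * p\<close>.\<close>
  define \<mu> where "\<mu> = p / Q"
  have "\<mu> \<ge> 0" using \<open>p \<ge> 0\<close> Q_pos by (simp add: \<mu>_def)
  have Em: "E \<in> events" unfolding E_eq[symmetric]
  proof -
    have "{\<omega> \<in> space M. \<exists>k\<le>n. S n n \<omega> - S n k \<omega> \<ge> p} = (\<Union>k\<in>{..n}. {\<omega> \<in> space M. S n n \<omega> - S n k \<omega> \<ge> p})"
      by auto
    then show "{\<omega> \<in> space M. \<exists>k\<le>n. S n n \<omega> - S n k \<omega> \<ge> p} \<in> events" by simp
  qed
  have "emeasure M E = (\<integral>\<^sup>+\<omega>. indicator E \<omega> \<partial>M)" using Em by simp
  also have "\<dots> \<le> (\<integral>\<^sup>+\<omega>. ennreal (exp (0 * (\<Sum>i<n. Y (n - Suc i) \<omega>) - 0\<^sup>2 * (\<Sum>i<n. (\<sigma> (n - Suc i))\<^sup>2) / 2)) *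
      indicator {\<omega>. \<exists>k\<le>n. (\<Sum>i<k. Y (n - Suc i) \<omega>) - 0 * (\<Sum>i<k. (\<sigma> (n - Suc i))\<^sup>2) \<ge> p} \<omega> \<partial>M)"
    by (intro nn_integral_mono) (auto simp: E_def indicator_def)
  also have "\<dots> \<le> ennreal (exp (\<mu>\<^sup>2 * (\<Sum>i<n. (\<sigma> (n - Suc i))\<^sup>2) / 2 - \<mu> * p))"
  proof (rule indep_normal_tilted_maximal[OF ind])
    fix i
    show "\<sigma> (n - Suc i) > 0" unfolding \<sigma>_def by (rule weight_pos) fact
    show "distributed M lborel (Y (n - Suc i)) (normal_density 0 (\<sigma> (n - Suc i)))"
      unfolding Y_def[abs_def] \<sigma>_def by (rule weighted_increments(2)[OF \<open>n > 0\<close>])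
  qed fact
  also have "\<dots> \<le> ennreal (exp (- p\<^sup>2 / (2 * Q)))"
  proof -
    have "\<mu>\<^sup>2 * (\<Sum>i<n. (\<sigma> (n - Suc i))\<^sup>2) / 2 \<le> \<mu>\<^sup>2 * Q / 2"
      using V by (intro divide_right_mono mult_left_mono) auto
    moreover have "\<mu>\<^sup>2 * Q / 2 - \<mu> * p = - p\<^sup>2 / (2 * Q)"
      using Q_pos by (simp add: \<mu>_def field_simps power2_eq_square)
    ultimately show ?thesis by (intro ennreal_leI) simp
  qed
  finally show ?thesis unfolding E_eq by (simp add: emeasure_eq_measure)
qed

text \<open>Where \<open>S n n \<ge> p\<close>, the tilting density is at least
  \<open>exp (\<theta> * p - \<theta>\<^sup>2 * Q / 2)\<close>, so the probability is at most the
  tilted one divided by this constant. Under the tilt the mean of \<open>S n k\<close> is \<theta>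
  times its variance, which is at most \<open>\<theta> * exp_var \<gamma> (real k * T / n)\<close>.
  An excess of \<open>r\<close> over the latter is therefore a crossing by the recentred sums and
  costs a further Gaussian factor.\<close>

lemma prob_tilted_maximal:
  assumes "n > 0" "\<theta> \<ge> 0" "r \<ge> 0"
  shows "prob {\<omega> \<in> space M. S n n \<omega> \<ge> p \<and> (\<exists>k\<le>n. S n k \<omega> - \<theta> * exp_var \<gamma> (real k * T / n) \<ge> r)}
    \<le> exp (- \<theta> * p + \<theta>\<^sup>2 * Q / 2 - r\<^sup>2 / (2 * Q))" (is "prob ?E \<le> _")
proof -
  define Y where "Y i \<omega> = exp (\<gamma> * (real i * T / real n)) *
      (B (real (Suc i) * T / real n) \<omega> - B (real i * T / real n) \<omega>)" for i \<omega>
  define \<sigma> where "\<sigma> i = exp (\<gamma> * (real i * T / real n)) * sqrt (T / n)" for i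
  define V where "V k = (\<Sum>i<k. (\<sigma> i)\<^sup>2)" for k
  have S: "S n k \<omega> = (\<Sum>i<k. Y i \<omega>)" for k \<omega> by (simp add: wiener_sum_def Y_def)
  have V: "V k \<le> exp_var \<gamma> (real k * T / n)" for k
    using exp_var_sum_le[OF \<gamma> T \<open>n > 0\<close>, of k] by (simp add: V_def exp_var_sum_def \<sigma>_def)
  have VQ: "V n \<le> Q" using V[of n] \<open>n > 0\<close> by simp
  define \<mu> where "\<mu> = r / Q"
  have "\<mu> \<ge> 0" using \<open>r \<ge> 0\<close> Q_pos by (simp add: \<mu>_def)
  have E: "?E \<in> events"
  proof -
    have "?E = {\<omega> \<in> space M. S n n \<omega> \<ge> p} \<inter>
        (\<Union>k\<in>{..n}. {\<omega> \<in> space M. S n k \<omega> - \<theta> * exp_var \<gamma> (real k * T / n) \<ge> r})"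
      by auto
    then show ?thesis by simp
  qed
  have "ennreal (exp (\<theta> * p - \<theta>\<^sup>2 * Q / 2)) * emeasure M ?E =
      (\<integral>\<^sup>+\<omega>. ennreal (exp (\<theta> * p - \<theta>\<^sup>2 * Q / 2)) * indicator ?E \<omega> \<partial>M)"
    using E by (simp add: nn_integral_cmult_indicator)
  also have "\<dots> \<le> (\<integral>\<^sup>+\<omega>. ennreal (exp (\<theta> * (\<Sum>i<n. Y i \<omega>) - \<theta>\<^sup>2 * V n / 2)) *
      indicator {\<omega>. \<exists>k\<le>n. (\<Sum>i<k. Y i \<omega>) - \<theta> * V k \<ge> r} \<omega> \<partial>M)"
  proof (rule nn_integral_mono)
    fix \<omega>
    show "ennreal (exp (\<theta> * p - \<theta>\<^sup>2 * Q / 2)) * indicator ?E \<omega> \<le>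
      ennreal (exp (\<theta> * (\<Sum>i<n. Y i \<omega>) - \<theta>\<^sup>2 * V n / 2)) *
      indicator {\<omega>. \<exists>k\<le>n. (\<Sum>i<k. Y i \<omega>) - \<theta> * V k \<ge> r} \<omega>"
    proof (cases "\<omega> \<in> ?E")
      case True
      then obtain k where k: "k \<le> n" "r \<le> S n k \<omega> - \<theta> * exp_var \<gamma> (real k * T / n)" by blast
      have "\<theta> * V k \<le> \<theta> * exp_var \<gamma> (real k * T / n)" by (rule mult_left_mono[OF V \<open>\<theta> \<ge> 0\<close>])
      with k have "\<exists>k\<le>n. (\<Sum>i<k. Y i \<omega>) - \<theta> * V k \<ge> r"
        by (intro exI[of _ k]) (simp add: S)
      moreover have "\<theta> * p \<le> \<theta> * (\<Sum>i<n. Y i \<omega>)"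
        using True \<open>\<theta> \<ge> 0\<close> by (intro mult_left_mono) (auto simp: S)
      moreover have "\<theta>\<^sup>2 * V n / 2 \<le> \<theta>\<^sup>2 * Q / 2"
        using VQ by (intro divide_right_mono mult_left_mono) auto
      ultimately show ?thesis by (auto simp: indicator_def intro!: ennreal_leI)
    qed simp
  qed
  also have "\<dots> \<le> ennreal (exp (\<mu>\<^sup>2 * V n / 2 - \<mu> * r))"
    unfolding V_def
  proof (rule indep_normal_tilted_maximal)
    show "indep_vars (\<lambda>_. borel) Y {..<n}"
      unfolding Y_def[abs_def] by (rule weighted_increments(1)[OF \<open>n > 0\<close>])
    fix i
    show "\<sigma> i > 0" unfolding \<sigma>_def by (rule weight_pos) fact
    show "distributed M lborel (Y i) (normal_density 0 (\<sigma> i))"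
      unfolding Y_def[abs_def] \<sigma>_def by (rule weighted_increments(2)[OF \<open>n > 0\<close>])
  qed fact
  also have "\<dots> \<le> ennreal (exp (- r\<^sup>2 / (2 * Q)))"
  proof -
    have "\<mu>\<^sup>2 * V n / 2 \<le> \<mu>\<^sup>2 * Q / 2"
      using VQ by (intro divide_right_mono mult_left_mono) auto
    moreover have "\<mu>\<^sup>2 * Q / 2 - \<mu> * r = - r\<^sup>2 / (2 * Q)"
      using Q_pos by (simp add: \<mu>_def field_simps power2_eq_square)
    ultimately show ?thesis by (intro ennreal_leI) simp
  qed
  finally have "exp (\<theta> * p - \<theta>\<^sup>2 * Q / 2) * prob ?E \<le> exp (- r\<^sup>2 / (2 * Q))"
    by (simp add: emeasure_eq_measure flip: ennreal_mult)
  note le = this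
  have "prob ?E = exp (- (\<theta> * p - \<theta>\<^sup>2 * Q / 2)) * (exp (\<theta> * p - \<theta>\<^sup>2 * Q / 2) * prob ?E)"
    by (simp add: mult_exp_exp flip: mult.assoc)
  also have "\<dots> \<le> exp (- (\<theta> * p - \<theta>\<^sup>2 * Q / 2)) * exp (- r\<^sup>2 / (2 * Q))"
    by (rule mult_left_mono[OF le]) simp
  also have "\<dots> = exp (- \<theta> * p + \<theta>\<^sup>2 * Q / 2 - r\<^sup>2 / (2 * Q))"
    by (simp add: mult_exp_exp)
  finally show ?thesis .
qed

text \<open>The sum is a centred normal variable whose density on \<open>{p..p+1}\<close> is
  smallest at the right end. This crude bound is sharp enough on the logarithmic scale.\<close>

lemma prob_S_ge:
  assumes "n > 0" "p \<ge> 0"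
  shows "normal_density 0 (sqrt (exp_var_sum \<gamma> T n n)) (p + 1) \<le> prob {\<omega> \<in> space M. S n n \<omega> \<ge> p}"
proof -
  define s where "s = sqrt (exp_var_sum \<gamma> T n n)"
  have "distributed M lborel (S n n) (normal_density (\<Sum>i<n. 0) s)"
    unfolding wiener_sum_def[abs_def] s_def exp_var_sum_def
    using \<open>n > 0\<close> by (intro sum_indep_normal weighted_increments weight_pos) auto
  then have D: "distributed M lborel (S n n) (normal_density 0 s)" by simp
  have "ennreal (normal_density 0 s (p + 1)) = (\<integral>\<^sup>+y. ennreal (normal_density 0 s (p + 1)) * indicator {p..p+1} y \<partial>lborel)"
    by (simp add: nn_integral_cmult_indicator)
  also have "\<dots> \<le> (\<integral>\<^sup>+y. ennreal (normal_density 0 s y) * indicator {p..} y \<partial>lborel)"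
  proof (rule nn_integral_mono)
    fix y
    have "normal_density 0 s (p + 1) \<le> normal_density 0 s y" if "y \<in> {p..p+1}"
    proof -
      have "y\<^sup>2 \<le> (p + 1)\<^sup>2" using that \<open>p \<ge> 0\<close> by (intro power_mono) auto
      then show ?thesis unfolding normal_density_def
        by (intro mult_left_mono) (auto simp: divide_right_mono)
    qed
    then show "ennreal (normal_density 0 s (p + 1)) * indicator {p..p+1} y \<le>
        ennreal (normal_density 0 s y) * indicator {p..} y"
      by (auto simp: indicator_def intro!: ennreal_leI)
  qed
  also have "\<dots> = emeasure M (S n n -` {p..} \<inter> space M)"
    by (subst distributed_emeasure[OF D]) auto
  also have "S n n -` {p..} \<inter> space M = {\<omega> \<in> space M. S n n \<omega> \<ge> p}" by auto
  finally show ?thesis unfolding s_def by (simp add: emeasure_eq_measure)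
qed

end

subsection \<open>The exponential rate\<close>

context brownian
begin

abbreviation "J \<omega> \<equiv> exp_stieltjes \<gamma> (\<lambda>t. B t \<omega>)"

lemma AE_continuous: "AE \<omega> in M. B 0 \<omega> = 0 \<and> continuous_on {0..} (\<lambda>t. B t \<omega>)"
  using bm by (auto simp: standard_brownian_motion_def)

lemma S_LIMSEQ:
  assumes "B 0 \<omega> = 0" "continuous_on {0..} (\<lambda>t. B t \<omega>)" "\<tau> \<in> {0..T}"
  shows "(\<lambda>n. S n (nat \<lfloor>\<tau> * real n / T\<rfloor>) \<omega>) \<longlonglongrightarrow> J \<omega> \<tau>"
  using exp_stieltjes_LIMSEQ[OF \<gamma> T assms(3), of "\<lambda>t. B t \<omega>"] assms
  by (simp add: wiener_sum_def continuous_on_subset)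

lemma S_LIMSEQ_end:
  assumes "B 0 \<omega> = 0" "continuous_on {0..} (\<lambda>t. B t \<omega>)"
  shows "(\<lambda>n. S n n \<omega>) \<longlonglongrightarrow> J \<omega> T"
  using S_LIMSEQ[OF assms, of T] T by simp

context
  fixes \<alpha> \<beta> d x b :: real and Z L U :: "real \<Rightarrow> 'a \<Rightarrow> real"
  assumes \<alpha>: "\<alpha> > 0" and \<beta>: "\<beta> > 0" and x: "x \<ge> 0"
    and OU: "doubly_reflected_OU M B \<alpha> \<gamma> \<beta> d x Z L U"
begin

lemma Z_measurable [measurable]: "Z T \<in> borel_measurable M"
  using OU T by (simp add: doubly_reflected_OU_def)

lemma AE_reflected:
  "AE \<omega> in M. doubly_reflected_path \<alpha> \<gamma> d x (\<lambda>t. \<beta> * B t \<omega>) (\<lambda>t. Z t \<omega>) (\<lambda>t. L t \<omega>) (\<lambda>t. U t \<omega>)"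
  using OU by (simp add: doubly_reflected_OU_def)

text \<open>The unit margins in the next two bounds absorb the passage from Riemann sums to their limit;
  they are negligible because \<open>p\<close> and \<open>r\<close> are of order \<open>1 / \<surd>\<epsilon>\<close>.\<close>

lemma prob_reflected_le:
  defines "p \<equiv> (exp (\<gamma> * T) * b - x - \<alpha> / \<gamma> * (exp (\<gamma> * T) - 1)) / \<beta>"
  assumes "p \<ge> 1"
  shows "prob {\<omega> \<in> space M. Z T \<omega> \<ge> b} \<le> exp (- (p - 1)\<^sup>2 / (2 * Q))"
proof (rule prob_le_eventually)
  let ?A = "\<lambda>n. {\<omega> \<in> space M. \<exists>k\<le>n. S n n \<omega> - S n k \<omega> \<ge> p - 1}"
  show "?A n \<in> events" for n
  proof -
    have "?A n = (\<Union>k\<in>{..n}. {\<omega> \<in> space M. S n n \<omega> - S n k \<omega> \<ge> p - 1})" by auto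
    then show ?thesis by simp
  qed
  show "\<forall>\<^sub>F n in sequentially. prob (?A n) \<le> exp (- (p - 1)\<^sup>2 / (2 * Q))"
    using assms by (intro eventually_sequentiallyI[of 1] prob_backward_maximal) auto
  show "AE \<omega> in M. \<omega> \<in> {\<omega> \<in> space M. Z T \<omega> \<ge> b} \<longrightarrow> (\<forall>\<^sub>F n in sequentially. \<omega> \<in> ?A n)"
    using AE_continuous AE_reflected
  proof eventually_elim
    case (elim \<omega>)
    show ?case
    proof safe
      assume "\<omega> \<in> space M" "Z T \<omega> \<ge> b"
      have "continuous_on {0..} (\<lambda>t. \<beta> * B t \<omega>)" using elim by (intro continuous_intros) auto
      then obtain \<tau> where \<tau>: "\<tau> \<in> {0..T}"
        "exp (\<gamma> * T) * b - x - \<alpha> / \<gamma> * (exp (\<gamma> * T) - 1) \<le> \<beta> * J \<omega> T - \<beta> * J \<omega> \<tau>"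
        using reflected_large_imp_noise_large[OF elim(2) _ \<gamma> \<alpha> x T _ \<open>Z T \<omega> \<ge> b\<close>] elim(1)
        unfolding exp_stieltjes_cmult by auto
      then have "p \<le> J \<omega> T - J \<omega> \<tau>"
        unfolding p_def pos_divide_le_eq[OF \<beta>] by (simp only: right_diff_distrib[of \<beta>] mult.commute[of _ \<beta>])
      then have "p - 1 < J \<omega> T - J \<omega> \<tau>" by simp
      moreover have "(\<lambda>n. S n n \<omega> - S n (nat \<lfloor>\<tau> * real n / T\<rfloor>) \<omega>) \<longlonglongrightarrow> J \<omega> T - J \<omega> \<tau>"
        using elim(1) \<tau>(1) by (intro tendsto_diff S_LIMSEQ S_LIMSEQ_end) auto
      ultimately have "\<forall>\<^sub>F n in sequentially. p - 1 < S n n \<omega> - S n (nat \<lfloor>\<tau> * real n / T\<rfloor>) \<omega>"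
        by (rule order_tendstoD(1)[rotated])
      then show "\<forall>\<^sub>F n in sequentially. \<omega> \<in> ?A n"
        using eventually_gt_at_top[of 0]
      proof eventually_elim
        case (elim n)
        then show ?case using grid_index_bounds(3)[OF T \<tau>(1), of n] \<open>\<omega> \<in> space M\<close>
          by (auto intro!: exI[of _ "nat \<lfloor>\<tau> * real n / T\<rfloor>"])
      qed
    qed
  qed
qed simp_all

lemma prob_reflected_ge:
  fixes y0 \<rho> :: real
  defines "K \<equiv> exp (\<gamma> * T) * b - y0 - \<alpha> / \<gamma> * (exp (\<gamma> * T) - 1)"
  defines "p \<equiv> K / \<beta>" and "r \<equiv> \<rho> / \<beta>"
  assumes "y0 \<le> x" "p \<ge> 0" "r \<ge> 1"
    and below: "\<And>t. t \<in> {0..T} \<Longrightarrow>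
      y0 + \<alpha> / \<gamma> * (exp (\<gamma> * t) - 1) + K * exp_var \<gamma> t / Q + \<rho> \<le> d * exp (\<gamma> * t)"
  shows "normal_density 0 (sqrt Q) (p + 1) - exp (- (p / Q) * (p - 1) + (p / Q)\<^sup>2 * Q / 2 - (r - 1)\<^sup>2 / (2 * Q))
    \<le> prob {\<omega> \<in> space M. Z T \<omega> \<ge> b}"
proof -
  \<comment> \<open>The tilt under which \<theta> times the variance \<open>Q\<close> equals
    \<open>p\<close>. Scaled by \<beta>, the mean of the noise integral at time \<open>t\<close>
    becomes \<open>K * exp_var \<gamma> t / Q\<close>, the term in \<open>below\<close>.\<close>
  define \<theta> where "\<theta> = p / Q"
  have "\<theta> \<ge> 0" using Q_pos \<open>p \<ge> 0\<close> by (simp add: \<theta>_def)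
  let ?G = "exp (- \<theta> * (p - 1) + \<theta>\<^sup>2 * Q / 2 - (r - 1)\<^sup>2 / (2 * Q))"
  let ?C = "\<lambda>n. {\<omega> \<in> space M. S n n \<omega> \<ge> p - 1 \<and>
    (\<exists>k\<le>n. S n k \<omega> - \<theta> * exp_var \<gamma> (real k * T / n) \<ge> r - 1)}"
  let ?D = "\<lambda>n. {\<omega> \<in> space M. S n n \<omega> < p}"
  have C_meas: "?C n \<in> events" for n
  proof -
    have "?C n = {\<omega> \<in> space M. S n n \<omega> \<ge> p - 1} \<inter>
        (\<Union>k\<in>{..n}. {\<omega> \<in> space M. S n k \<omega> - \<theta> * exp_var \<gamma> (real k * T / n) \<ge> r - 1})" by auto
    then show ?thesis by simp
  qed
  \<comment> \<open>Fatou transfers upper bounds, so the complement is estimated: either the final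
    sum stays below \<open>p\<close>, or it is about \<open>p\<close> or more and the sums leave the
    tilted mean path by a wide margin.\<close>
  have "prob {\<omega> \<in> space M. Z T \<omega> < b} \<le> 1 - normal_density 0 (sqrt Q) (p + 1) + ?G"
  proof (rule prob_le_eventually)
    show "?D n \<union> ?C n \<in> events" for n using C_meas by (intro sets.Un) simp_all
    show "\<forall>\<^sub>F n in sequentially. prob (?D n \<union> ?C n) \<le>
        1 - normal_density 0 (sqrt (exp_var_sum \<gamma> T n n)) (p + 1) + ?G"
      using eventually_gt_at_top[of 0]
    proof eventually_elim
      case (elim n)
      have "prob (?D n) = 1 - prob {\<omega> \<in> space M. S n n \<omega> \<ge> p}"
      proof -
        have "?D n = space M - {\<omega> \<in> space M. S n n \<omega> \<ge> p}" by auto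
        then show ?thesis by (simp add: prob_compl)
      qed
      also have "\<dots> \<le> 1 - normal_density 0 (sqrt (exp_var_sum \<gamma> T n n)) (p + 1)"
        using prob_S_ge[OF elim \<open>p \<ge> 0\<close>] by simp
      finally have "prob (?D n) \<le> 1 - normal_density 0 (sqrt (exp_var_sum \<gamma> T n n)) (p + 1)" .
      moreover have "prob (?C n) \<le> ?G"
        using \<open>r \<ge> 1\<close> by (intro prob_tilted_maximal elim \<open>\<theta> \<ge> 0\<close>) simp
      moreover have "prob (?D n \<union> ?C n) \<le> prob (?D n) + prob (?C n)"
        using C_meas by (intro measure_Un_le) simp_all
      ultimately show ?case by linarith
    qed
    have "sqrt Q \<noteq> 0" using Q_pos by simp
    then show "(\<lambda>n. 1 - normal_density 0 (sqrt (exp_var_sum \<gamma> T n n)) (p + 1) + ?G) \<longlonglongrightarrow>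
        1 - normal_density 0 (sqrt Q) (p + 1) + ?G"
      unfolding normal_density_def using Q_pos
      by (intro tendsto_intros exp_var_sum_LIMSEQ \<gamma> T) auto
    show "AE \<omega> in M. \<omega> \<in> {\<omega> \<in> space M. Z T \<omega> < b} \<longrightarrow> (\<forall>\<^sub>F n in sequentially. \<omega> \<in> ?D n \<union> ?C n)"
      using AE_continuous AE_reflected
    proof eventually_elim
      case (elim \<omega>)
      show ?case
      proof safe
        assume \<omega>: "\<omega> \<in> space M" "Z T \<omega> < b"
        have cont: "continuous_on {0..} (\<lambda>t. \<beta> * B t \<omega>)" using elim by (intro continuous_intros) auto
        have end_lim: "(\<lambda>n. S n n \<omega>) \<longlonglongrightarrow> J \<omega> T" using elim by (intro S_LIMSEQ_end) auto
        show "\<forall>\<^sub>F n in sequentially. \<omega> \<in> ?D n \<union> ?C n"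
        proof (cases "J \<omega> T < p")
          case True
          with end_lim have "\<forall>\<^sub>F n in sequentially. S n n \<omega> < p" by (rule order_tendstoD(2))
          then show ?thesis by eventually_elim (use \<omega> in simp)
        next
          case False
          \<comment> \<open>Otherwise the unreflected path would bound \<open>Z T\<close> from
            below, and with \<open>J \<omega> T \<ge> p\<close> it ends at \<open>b\<close> or
            higher.\<close>
          have "\<exists>t\<in>{0..T}. y0 + \<alpha> / \<gamma> * (exp (\<gamma> * t) - 1) + \<beta> * J \<omega> t > d * exp (\<gamma> * t)"
          proof (rule ccontr)
            assume "\<not> ?thesis"
            then have "y0 + \<alpha> / \<gamma> * (exp (\<gamma> * T) - 1) + \<beta> * J \<omega> T \<le> exp (\<gamma> * T) * Z T \<omega>"
              using unreflected_le_reflected[OF elim(2) cont \<gamma> _ \<open>y0 \<le> x\<close>, of T] T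
              by (simp add: exp_stieltjes_cmult not_less)
            moreover have "K \<le> \<beta> * J \<omega> T" using False \<beta> by (simp add: p_def field_simps)
            ultimately have "exp (\<gamma> * T) * b \<le> exp (\<gamma> * T) * Z T \<omega>" unfolding K_def by linarith
            with \<omega>(2) show False by simp
          qed
          then obtain t where t: "t \<in> {0..T}"
            "y0 + \<alpha> / \<gamma> * (exp (\<gamma> * t) - 1) + \<beta> * J \<omega> t > d * exp (\<gamma> * t)" by blast
          have "K * exp_var \<gamma> t / Q + \<rho> < \<beta> * J \<omega> t" using t(2) below[OF t(1)] by linarith
          then have "r < J \<omega> t - \<theta> * exp_var \<gamma> t"
            using \<beta> by (simp add: r_def \<theta>_def p_def field_simps)
          then have "r - 1 < J \<omega> t - \<theta> * exp_var \<gamma> t" by simp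
          moreover have "(\<lambda>n. S n (nat \<lfloor>t * real n / T\<rfloor>) \<omega> - \<theta> * exp_var \<gamma> t) \<longlonglongrightarrow>
              J \<omega> t - \<theta> * exp_var \<gamma> t"
            using elim(1) t(1) by (intro tendsto_intros S_LIMSEQ) auto
          ultimately have 1: "\<forall>\<^sub>F n in sequentially. r - 1 < S n (nat \<lfloor>t * real n / T\<rfloor>) \<omega> - \<theta> * exp_var \<gamma> t"
            by (rule order_tendstoD(1)[rotated])
          have "p - 1 < J \<omega> T" using False by simp
          with end_lim have "\<forall>\<^sub>F n in sequentially. p - 1 < S n n \<omega>" by (rule order_tendstoD(1))
          with 1 show ?thesis
            using eventually_gt_at_top[of 0]
          proof eventually_elim
            case (elim n)
            define k where "k = nat \<lfloor>t * real n / T\<rfloor>"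
            have k: "k \<le> n" "real k * T / n \<le> t"
              using grid_index_bounds[OF T t(1) elim(3)] by (simp_all add: k_def)
            \<comment> \<open>The grid point lies to the left of \<open>t\<close>, so its recentring
              term is the smaller one and the crossing persists.\<close>
            have "\<theta> * exp_var \<gamma> (real k * T / n) \<le> \<theta> * exp_var \<gamma> t"
              by (intro mult_left_mono exp_var_mono \<gamma> k \<open>\<theta> \<ge> 0\<close>)
            with elim have "S n k \<omega> - \<theta> * exp_var \<gamma> (real k * T / n) \<ge> r - 1" by (simp add: k_def)
            with k(1) \<omega>(1) elim(2) show ?case by auto
          qed
        qed
      qed
    qed
  qed simp
  moreover have "prob {\<omega> \<in> space M. Z T \<omega> < b} = 1 - prob {\<omega> \<in> space M. Z T \<omega> \<ge> b}"
  proof -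
    have "{\<omega> \<in> space M. Z T \<omega> < b} = space M - {\<omega> \<in> space M. Z T \<omega> \<ge> b}" by auto
    then show ?thesis by (simp add: prob_compl)
  qed
  ultimately show ?thesis by (simp add: \<theta>_def)
qed

end

end

section \<open>Bounds on the optimal unreflected path\<close>

lemma two_point_weights_le:
  fixes u v :: real
  assumes "1 \<le> u" "u \<le> v" "1 < v" "A \<le> m" "B \<le> m" "0 \<le> m"
  shows "A * ((v\<^sup>2 - u\<^sup>2) / (v\<^sup>2 - 1)) + B * (v * (u\<^sup>2 - 1) / (v\<^sup>2 - 1)) \<le> m * u"
proof -
  have v: "v\<^sup>2 - 1 > 0" using assms by (simp add: one_less_power)
  have w: "(v\<^sup>2 - u\<^sup>2) / (v\<^sup>2 - 1) \<ge> 0" "v * (u\<^sup>2 - 1) / (v\<^sup>2 - 1) \<ge> 0"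
    using assms v by (auto intro!: divide_nonneg_pos mult_nonneg_nonneg power_mono simp: one_le_power)
  \<comment> \<open>This product is exactly the gap between \<open>u * (v\<^sup>2 - 1)\<close> and
    the sum of the numerators of the two weights. Hence the nonnegative weights add up to at most
    \<open>u\<close>.\<close>
  have "0 \<le> (v - 1) * ((u - 1) * (v - u))" using assms by (intro mult_nonneg_nonneg) auto
  then have "v\<^sup>2 - u\<^sup>2 + v * (u\<^sup>2 - 1) \<le> u * (v\<^sup>2 - 1)"
    by (simp add: power2_eq_square algebra_simps)
  then have sum: "(v\<^sup>2 - u\<^sup>2) / (v\<^sup>2 - 1) + v * (u\<^sup>2 - 1) / (v\<^sup>2 - 1) \<le> u"
    using v by (simp add: pos_divide_le_eq flip: add_divide_distrib)
  have "A * ((v\<^sup>2 - u\<^sup>2) / (v\<^sup>2 - 1)) + B * (v * (u\<^sup>2 - 1) / (v\<^sup>2 - 1)) \<le>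
      m * ((v\<^sup>2 - u\<^sup>2) / (v\<^sup>2 - 1)) + m * (v * (u\<^sup>2 - 1) / (v\<^sup>2 - 1))"
    using assms w by (intro add_mono mult_right_mono) auto
  also have "\<dots> \<le> m * u"
    unfolding distrib_left[symmetric] using sum assms by (intro mult_left_mono) auto
  finally show ?thesis .
qed

context
  fixes \<gamma> T t a b y :: real
  assumes \<gamma>: "\<gamma> > 0" and T: "T > 0" and t: "t \<in> {0..T}"
begin

text \<open>Measured from the equilibrium \<open>a\<close>, the path is a combination with
  nonnegative weights of the initial and final deviations \<open>y - a\<close> and
  \<open>b - a\<close>. A common bound on \<open>a\<close>, \<open>y\<close> and \<open>b\<close> is
  thereby passed on to the whole path.\<close>

lemma optimal_path_interpolation:
  "y + a * (exp (\<gamma> * t) - 1) +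
      (exp (\<gamma> * T) * b - y - a * (exp (\<gamma> * T) - 1)) * exp_var \<gamma> t / exp_var \<gamma> T =
    a * exp (\<gamma> * t) +
    ((y - a) * (((exp (\<gamma> * T))\<^sup>2 - (exp (\<gamma> * t))\<^sup>2) / ((exp (\<gamma> * T))\<^sup>2 - 1)) +
     (b - a) * (exp (\<gamma> * T) * ((exp (\<gamma> * t))\<^sup>2 - 1) / ((exp (\<gamma> * T))\<^sup>2 - 1)))"
proof -
  define u v where "u = exp (\<gamma> * t)" and "v = exp (\<gamma> * T)"
  have "v > 1" using \<gamma> T by (simp add: v_def)
  then have v: "v\<^sup>2 - 1 > 0" by (simp add: one_less_power)
  have q: "exp_var \<gamma> t / exp_var \<gamma> T = (u\<^sup>2 - 1) / (v\<^sup>2 - 1)"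
    using \<gamma> by (simp add: exp_var_def u_def v_def mult.assoc flip: exp_double)
  have "y + a * (u - 1) + (v * b - y - a * (v - 1)) * ((u\<^sup>2 - 1) / (v\<^sup>2 - 1)) =
      a * u + ((y - a) * ((v\<^sup>2 - u\<^sup>2) / (v\<^sup>2 - 1)) + (b - a) * (v * (u\<^sup>2 - 1) / (v\<^sup>2 - 1)))"
    using v by (simp add: divide_simps) (simp add: algebra_simps power2_eq_square)
  then show ?thesis by (simp only: u_def v_def times_divide_eq_right[symmetric] q)
qed

lemma exp_bounds: "1 \<le> exp (\<gamma> * t)" "exp (\<gamma> * t) \<le> exp (\<gamma> * T)" "1 < exp (\<gamma> * T)"
  using \<gamma> T t by auto

lemma optimal_path_le:
  assumes "a \<le> c" "y \<le> c" "b \<le> c"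
  shows "y + a * (exp (\<gamma> * t) - 1) +
      (exp (\<gamma> * T) * b - y - a * (exp (\<gamma> * T) - 1)) * exp_var \<gamma> t / exp_var \<gamma> T \<le> c * exp (\<gamma> * t)"
  unfolding optimal_path_interpolation
  using two_point_weights_le[OF exp_bounds, of "y - a" "c - a" "b - a"] assms
  by (simp add: left_diff_distrib)

lemma optimal_path_ge:
  assumes "c \<le> a" "c \<le> y" "c \<le> b"
  shows "c * exp (\<gamma> * t) \<le> y + a * (exp (\<gamma> * t) - 1) +
      (exp (\<gamma> * T) * b - y - a * (exp (\<gamma> * T) - 1)) * exp_var \<gamma> t / exp_var \<gamma> T"
  unfolding optimal_path_interpolation
  using two_point_weights_le[OF exp_bounds, of "a - y" "a - c" "a - b"] assms
  by (simp add: left_diff_distrib diff_divide_distrib)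

end

text \<open>The square beats the linear term: from s = (4k + 2c + 1)/c^2 on, the numerator is at
  most \<open>- s\<close>. With \<open>s\<close> the inverse of \<open>sqrt \<epsilon>\<close>, this
  is the relative cost of exceeding \<open>d\<close>.\<close>

lemma tail_correction_small:
  fixes k c Q \<delta> :: real
  assumes "c > 0" "Q > 0" "\<delta> > 0"
  shows "\<forall>\<^sub>F s in at_top. exp ((4 * (k * s) + 1 - (c * s - 1)\<^sup>2) / (2 * Q)) \<le> \<delta>"
  using eventually_ge_at_top[of "(4 * k + 2 * c + 1) / c\<^sup>2"] eventually_ge_at_top[of "- ln \<delta> * (2 * Q)"]
    eventually_ge_at_top[of "0::real"]
proof eventually_elim
  case (elim s)
  have "4 * k + 2 * c + 1 \<le> s * c\<^sup>2" using elim(1) assms by (simp add: divide_le_eq)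
  then have "s * (4 * k + 2 * c - s * c\<^sup>2) \<le> s * (- 1)" using elim(3) by (intro mult_left_mono) auto
  then have "4 * (k * s) + 1 - (c * s - 1)\<^sup>2 \<le> - s" by (simp add: power2_eq_square algebra_simps)
  also have "\<dots> \<le> ln \<delta> * (2 * Q)" using elim(2) by simp
  finally have "(4 * (k * s) + 1 - (c * s - 1)\<^sup>2) / (2 * Q) \<le> ln \<delta>"
    using assms by (simp add: pos_divide_le_eq)
  then show ?case using assms(3) by (simp add: ln_ge_iff)
qed

section \<open>Logarithmic asymptotics as the noise vanishes\<close>

context brownian
begin

context
  fixes \<alpha> \<sigma> d x b :: real and Z L U :: "real \<Rightarrow> real \<Rightarrow> 'a \<Rightarrow> real"
  assumes \<alpha>: "\<alpha> > 0" and \<sigma>: "\<sigma> > 0" and d: "d > \<alpha> / \<gamma>" and x: "x \<in> {0..d}" and b: "b < d"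
    and OU: "\<And>\<epsilon>. \<epsilon> > 0 \<Longrightarrow>
      doubly_reflected_OU M B \<alpha> \<gamma> (sqrt \<epsilon> * \<sigma>) d x (Z \<epsilon>) (L \<epsilon>) (U \<epsilon>)"
    and b_gt: "exp (\<gamma> * T) * b - x - \<alpha> / \<gamma> * (exp (\<gamma> * T) - 1) > 0"
begin

private abbreviation (input) "P \<epsilon> \<equiv> prob {\<omega> \<in> space M. Z \<epsilon> T \<omega> \<ge> b}"
private abbreviation (input) "K y \<equiv> exp (\<gamma> * T) * b - y - \<alpha> / \<gamma> * (exp (\<gamma> * T) - 1)"

lemma log_prob_upper: "\<forall>\<^sub>F \<epsilon> in at_right 0. P \<epsilon> \<le> exp (- (K x / (sqrt \<epsilon> * \<sigma>) - 1)\<^sup>2 / (2 * Q))"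
proof -
  \<comment> \<open>For such \<epsilon> the level \<open>K x / (sqrt \<epsilon> * \<sigma>)\<close>
    is at least 1, as \<open>prob_reflected_le\<close> requires.\<close>
  have "\<forall>\<^sub>F \<epsilon> in at_right 0. \<epsilon> < (K x / \<sigma>)\<^sup>2"
    by (rule order_tendstoD(2)[OF tendsto_ident_at]) (use b_gt \<sigma> in simp)
  then show ?thesis using eventually_at_right_less
  proof eventually_elim
    case (elim \<epsilon>)
    have "sqrt \<epsilon> \<le> K x / \<sigma>"
    proof (rule real_le_lsqrt)
      show "0 \<le> K x / \<sigma>" using b_gt \<sigma> by (intro divide_nonneg_pos) auto
    qed (use elim in simp)
    then have "sqrt \<epsilon> * \<sigma> \<le> K x" using \<sigma> by (subst (asm) pos_le_divide_eq)
    moreover have "sqrt \<epsilon> * \<sigma> > 0" using elim \<sigma> by simp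
    ultimately have "1 \<le> K x / (sqrt \<epsilon> * \<sigma>)" by (subst le_divide_eq_1_pos)
    then show ?case using OU elim x \<sigma>
      by (intro prob_reflected_le[OF \<alpha> _ _ OU]) auto
  qed
qed

text \<open>Starting from \<open>x - \<eta>\<close> leaves room below \<open>d\<close> even when
  \<open>x = d\<close>. The equilibrium, the new start and \<open>b\<close> are then all below
  \<open>d\<close>, so the optimal path keeps a margin \<rho> and the probability of exceeding
  \<open>d\<close> costs at most half of the Gaussian bound.\<close>

lemma log_prob_lower:
  assumes "\<eta> > 0"
  shows "\<forall>\<^sub>F \<epsilon> in at_right 0. normal_density 0 (sqrt Q) (K (x - \<eta>) / (sqrt \<epsilon> * \<sigma>) + 1) / 2 \<le> P \<epsilon>"
proof -
  define y where "y = x - \<eta>"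
  define c where "c = Max {\<alpha> / \<gamma>, y, b}"
  define \<rho> where "\<rho> = d - c"
  have c: "\<alpha> / \<gamma> \<le> c" "y \<le> c" "b \<le> c" "c < d"
    using d x b assms by (auto simp: c_def y_def)
  have "\<rho> > 0" using c by (simp add: \<rho>_def)
  have Ky: "K y > 0" using b_gt assms by (simp add: y_def)
  have below: "y + \<alpha> / \<gamma> * (exp (\<gamma> * t) - 1) + K y * exp_var \<gamma> t / Q + \<rho> \<le> d * exp (\<gamma> * t)"
    if t: "t \<in> {0..T}" for t
  proof -
    have "\<rho> * 1 \<le> \<rho> * exp (\<gamma> * t)" using t \<gamma> \<open>\<rho> > 0\<close> by (intro mult_left_mono) auto
    then show ?thesis using optimal_path_le[OF \<gamma> T t c(1-3)] by (simp add: \<rho>_def left_diff_distrib)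
  qed
  have inv: "filterlim (\<lambda>\<epsilon>. inverse (sqrt \<epsilon>)) at_top (at_right 0)"
  proof (rule filterlim_compose[OF filterlim_inverse_at_top_right])
    show "filterlim sqrt (at_right 0) (at_right 0)"
      unfolding filterlim_at by (auto intro!: tendsto_eq_intros simp: eventually_at_right_less)
        (auto simp: eventually_at_filter)
  qed
  have s2: "sqrt (2 * pi * Q) > 0" using Q_pos by simp
  have "\<forall>\<^sub>F s in at_top. exp ((4 * (K y / \<sigma> * s) + 1 - (\<rho> / \<sigma> * s - 1)\<^sup>2) / (2 * Q)) \<le> 1 / (2 * sqrt (2 * pi * Q))"
    using \<open>\<rho> > 0\<close> \<sigma> Q_pos s2 by (intro tail_correction_small) auto
  with inv have ev1: "\<forall>\<^sub>F \<epsilon> in at_right 0.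
      exp ((4 * (K y / \<sigma> * inverse (sqrt \<epsilon>)) + 1 - (\<rho> / \<sigma> * inverse (sqrt \<epsilon>) - 1)\<^sup>2) / (2 * Q))
      \<le> 1 / (2 * sqrt (2 * pi * Q))"
    unfolding filterlim_iff by blast
  have "\<forall>\<^sub>F s in at_top. \<sigma> / \<rho> \<le> (s::real)" by (rule eventually_ge_at_top)
  with inv have "\<forall>\<^sub>F \<epsilon> in at_right 0. \<sigma> / \<rho> \<le> inverse (sqrt \<epsilon>)"
    unfolding filterlim_iff by blast
  with ev1 show ?thesis using eventually_at_right_less
  proof eventually_elim
    case (elim \<epsilon>)
    define p r where "p = K y / (sqrt \<epsilon> * \<sigma>)" and "r = \<rho> / (sqrt \<epsilon> * \<sigma>)"
    have \<beta>: "sqrt \<epsilon> * \<sigma> > 0" using elim \<sigma> by simp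
    have pr: "p \<ge> 0" "r \<ge> 1"
      using elim(2,3) Ky \<beta> \<open>\<rho> > 0\<close> \<sigma> by (auto simp: p_def r_def field_simps)
    let ?G = "exp (- (p / Q) * (p - 1) + (p / Q)\<^sup>2 * Q / 2 - (r - 1)\<^sup>2 / (2 * Q))"
    have lower: "normal_density 0 (sqrt Q) (p + 1) - ?G \<le> P \<epsilon>"
      unfolding p_def r_def using pr below x \<sigma> assms elim(3)
      by (intro prob_reflected_ge[OF \<alpha> \<beta> _ OU]) (auto simp: p_def r_def y_def)
    have A: "normal_density 0 (sqrt Q) (p + 1) = exp (- (p + 1)\<^sup>2 / (2 * Q)) / sqrt (2 * pi * Q)"
      using Q_pos by (simp add: normal_density_def)
    \<comment> \<open>Factoring out the Gaussian weight of the main term leaves the exponent treated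
      by \<open>tail_correction_small\<close>.\<close>
    have "?G = exp (- (p + 1)\<^sup>2 / (2 * Q)) * exp ((4 * p + 1 - (r - 1)\<^sup>2) / (2 * Q))"
      using Q_pos by (simp add: mult_exp_exp) (simp add: field_simps power2_eq_square)
    also have "\<dots> \<le> exp (- (p + 1)\<^sup>2 / (2 * Q)) * (1 / (2 * sqrt (2 * pi * Q)))"
      using elim(1) by (intro mult_left_mono) (auto simp: p_def r_def field_simps)
    also have "\<dots> = normal_density 0 (sqrt Q) (p + 1) / 2" by (simp add: A)
    finally show ?case using lower by (simp add: p_def y_def)
  qed
qed

text \<open>Both bounds are Gaussian at a level of order 1/sqrt(\<epsilon>), shifted by one.
  Multiplying the exponent by \<epsilon> turns the shift into a multiple of
  \<open>sqrt \<epsilon>\<close>, which vanishes. In the lower bound \<eta> is fixed first, by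
  continuity of the rate in the starting point.\<close>

lemma log_prob: "((\<lambda>\<epsilon>. \<epsilon> * ln (P \<epsilon>)) \<longlongrightarrow> - ((K x)\<^sup>2 / (2 * Q * \<sigma>\<^sup>2))) (at_right 0)"
proof (rule order_tendstoI)
  have sqrt_lim: "((\<lambda>\<epsilon>. sqrt \<epsilon>) \<longlongrightarrow> 0) (at_right 0)" by (auto intro!: tendsto_eq_intros)
  have scale: "\<epsilon> * (k / (sqrt \<epsilon> * \<sigma>) + c)\<^sup>2 = (k / \<sigma> + c * sqrt \<epsilon>)\<^sup>2" if "\<epsilon> > 0" for \<epsilon> k c
  proof -
    have "\<epsilon> * (k / (sqrt \<epsilon> * \<sigma>) + c)\<^sup>2 = (sqrt \<epsilon> * (k / (sqrt \<epsilon> * \<sigma>) + c))\<^sup>2"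
      using that by (simp add: power_mult_distrib)
    also have "sqrt \<epsilon> * (k / (sqrt \<epsilon> * \<sigma>) + c) = k / \<sigma> + c * sqrt \<epsilon>"
      using that by (simp add: distrib_left)
    finally show ?thesis .
  qed
  have normal_pos: "normal_density 0 (sqrt Q) y > 0" for y
    using Q_pos by (intro normal_density_pos) simp
  {
    fix A assume "A > - ((K x)\<^sup>2 / (2 * Q * \<sigma>\<^sup>2))"
    moreover have "((\<lambda>\<epsilon>. - ((K x / \<sigma> + - 1 * sqrt \<epsilon>)\<^sup>2 / (2 * Q))) \<longlongrightarrow> - ((K x / \<sigma> + - 1 * 0)\<^sup>2 / (2 * Q)))
        (at_right 0)"
      using Q_pos by (intro tendsto_intros sqrt_lim) auto
    ultimately have "\<forall>\<^sub>F \<epsilon> in at_right 0. - ((K x / \<sigma> + - 1 * sqrt \<epsilon>)\<^sup>2 / (2 * Q)) < A"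
      by (intro order_tendstoD(2)) (auto simp: power_divide mult.commute)
    then show "\<forall>\<^sub>F \<epsilon> in at_right 0. \<epsilon> * ln (P \<epsilon>) < A"
      \<comment> \<open>The lower bound enters here only to make the probability positive, so that
        monotonicity of \<open>ln\<close> applies.\<close>
      using log_prob_upper log_prob_lower[OF zero_less_one] eventually_at_right_less
    proof eventually_elim
      case (elim \<epsilon>)
      have "P \<epsilon> > 0" using elim(3) normal_pos[of "K (x - 1) / (sqrt \<epsilon> * \<sigma>) + 1"] by linarith
      then have "ln (P \<epsilon>) \<le> - (K x / (sqrt \<epsilon> * \<sigma>) - 1)\<^sup>2 / (2 * Q)"
        using elim(2) by (subst ln_exp[symmetric], intro ln_mono) auto
      then have "\<epsilon> * ln (P \<epsilon>) \<le> \<epsilon> * (- (K x / (sqrt \<epsilon> * \<sigma>) + (- 1))\<^sup>2 / (2 * Q))"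
        using elim(4) by (intro mult_left_mono) auto
      also have "\<dots> = - (\<epsilon> * (K x / (sqrt \<epsilon> * \<sigma>) + (- 1))\<^sup>2 / (2 * Q))" by simp
      also have "\<dots> = - ((K x / \<sigma> + - 1 * sqrt \<epsilon>)\<^sup>2 / (2 * Q))"
        unfolding scale[OF elim(4)] ..
      finally show ?case using elim(1) by linarith
    qed
  }
  {
    fix A assume A: "A < - ((K x)\<^sup>2 / (2 * Q * \<sigma>\<^sup>2))"
    have "((\<lambda>\<eta>. - ((K (x - \<eta>))\<^sup>2 / (2 * Q * \<sigma>\<^sup>2))) \<longlongrightarrow> - ((K (x - 0))\<^sup>2 / (2 * Q * \<sigma>\<^sup>2))) (at_right 0)"
      using Q_pos \<sigma> by (intro tendsto_intros) auto
    then have "\<forall>\<^sub>F \<eta> in at_right 0. A < - ((K (x - \<eta>))\<^sup>2 / (2 * Q * \<sigma>\<^sup>2))"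
      using A by (intro order_tendstoD(1)) auto
    then have "\<forall>\<^sub>F \<eta> in at_right 0. A < - ((K (x - \<eta>))\<^sup>2 / (2 * Q * \<sigma>\<^sup>2)) \<and> 0 < \<eta>"
      using eventually_at_right_less by (rule eventually_conj)
    then obtain \<eta> where \<eta>: "A < - ((K (x - \<eta>))\<^sup>2 / (2 * Q * \<sigma>\<^sup>2))" "\<eta> > 0"
      using eventually_happens'[OF trivial_limit_at_right_real] by blast
    define C where "C = ln (2 * sqrt (2 * pi * Q))"
    have "((\<lambda>\<epsilon>. - ((K (x - \<eta>) / \<sigma> + 1 * sqrt \<epsilon>)\<^sup>2 / (2 * Q)) - \<epsilon> * C) \<longlongrightarrow>
        - ((K (x - \<eta>) / \<sigma> + 1 * 0)\<^sup>2 / (2 * Q)) - 0 * C) (at_right 0)"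
      using Q_pos by (intro tendsto_intros sqrt_lim) auto
    then have "\<forall>\<^sub>F \<epsilon> in at_right 0. A < - ((K (x - \<eta>) / \<sigma> + 1 * sqrt \<epsilon>)\<^sup>2 / (2 * Q)) - \<epsilon> * C"
      using \<eta>(1) by (intro order_tendstoD(1)) (auto simp: power_divide mult.commute)
    then show "\<forall>\<^sub>F \<epsilon> in at_right 0. A < \<epsilon> * ln (P \<epsilon>)"
      using log_prob_lower[OF \<eta>(2)] eventually_at_right_less
    proof eventually_elim
      case (elim \<epsilon>)
      define p where "p = K (x - \<eta>) / (sqrt \<epsilon> * \<sigma>)"
      have "normal_density 0 (sqrt Q) (p + 1) / 2 = exp (- (p + 1)\<^sup>2 / (2 * Q)) / (2 * sqrt (2 * pi * Q))"
        using Q_pos by (simp add: normal_density_def)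
      then have "ln (normal_density 0 (sqrt Q) (p + 1) / 2) = - (p + 1)\<^sup>2 / (2 * Q) - C"
        using Q_pos by (simp add: ln_div C_def)
      moreover have "ln (normal_density 0 (sqrt Q) (p + 1) / 2) \<le> ln (P \<epsilon>)"
        using elim(2) normal_pos[of "p + 1"] by (intro ln_mono) (auto simp: p_def)
      ultimately have "- (p + 1)\<^sup>2 / (2 * Q) - C \<le> ln (P \<epsilon>)" by simp
      then have "\<epsilon> * (- (p + 1)\<^sup>2 / (2 * Q) - C) \<le> \<epsilon> * ln (P \<epsilon>)"
        using elim(3) by (intro mult_left_mono) auto
      moreover have "\<epsilon> * (- (p + 1)\<^sup>2 / (2 * Q) - C) = - (\<epsilon> * (p + 1)\<^sup>2 / (2 * Q)) - \<epsilon> * C"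
        by (simp add: right_diff_distrib)
      moreover have "\<dots> = - ((K (x - \<eta>) / \<sigma> + 1 * sqrt \<epsilon>)\<^sup>2 / (2 * Q)) - \<epsilon> * C"
        unfolding p_def scale[OF elim(3)] ..
      ultimately show ?case using elim(1) by linarith
    qed
  }
qed

end

end

subsection \<open>The minimal cost path\<close>

lemma set_integrable_continuous_mult:
  fixes g \<phi> :: "real \<Rightarrow> real"
  assumes \<phi>: "set_integrable lborel {a..b} \<phi>" and g: "continuous_on {a..b} g"
  shows "set_integrable lborel {a..b} (\<lambda>s. g s * \<phi> s)"
proof -
  have "bounded (g ` {a..b})" using g by (intro compact_imp_bounded compact_continuous_image) auto
  then obtain C where C: "\<And>s. s \<in> {a..b} \<Longrightarrow> \<bar>g s\<bar> \<le> C" unfolding bounded_iff by fastforce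
  have eq: "indicator {a..b} s *\<^sub>R (g s * \<phi> s) = (indicator {a..b} s *\<^sub>R g s) * (indicator {a..b} s *\<^sub>R \<phi> s)" for s
    by (simp add: indicator_def)
  have [measurable]: "(\<lambda>s. indicator {a..b} s *\<^sub>R g s) \<in> borel_measurable borel"
    using g by (intro borel_measurable_continuous_on_indicator) auto
  have [measurable]: "(\<lambda>s. indicator {a..b} s *\<^sub>R \<phi> s) \<in> borel_measurable borel"
    using \<phi> unfolding set_integrable_def by (auto dest: borel_measurable_integrable)
  have "integrable lborel (\<lambda>s. C * (indicator {a..b} s *\<^sub>R \<phi> s))"
    using \<phi> unfolding set_integrable_def by (rule integrable_mult_right)
  then show ?thesis unfolding set_integrable_def eq
  proof (rule Bochner_Integration.integrable_bound)
    show "AE s in lborel. norm ((indicator {a..b} s *\<^sub>R g s) * (indicator {a..b} s *\<^sub>R \<phi> s)) \<le>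
        norm (C * (indicator {a..b} s *\<^sub>R \<phi> s))"
    proof (rule AE_I2)
      fix s show "norm ((indicator {a..b} s *\<^sub>R g s) * (indicator {a..b} s *\<^sub>R \<phi> s)) \<le>
        norm (C * (indicator {a..b} s *\<^sub>R \<phi> s))"
        using order_trans[OF C abs_ge_self, of s] by (auto simp: indicator_def abs_mult intro: mult_right_mono)
    qed
  qed measurable
qed

lemma LBINT_exp:
  fixes c :: real
  assumes "c \<noteq> 0" "s \<le> t"
  shows "(LBINT u:{s..t}. exp (c * u)) = (exp (c * t) - exp (c * s)) / c"
proof -
  have "(LBINT u:{s..t}. exp (c * u)) = exp (c * t) / c - exp (c * s) / c"
    unfolding set_lebesgue_integral_def using assms
    by (intro integral_FTC_atLeastAtMost)
      (auto intro!: derivative_eq_intros continuous_intros simp flip: has_real_derivative_iff_has_vector_derivative)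
  then show ?thesis by (simp add: diff_divide_distrib)
qed

lemma set_integrable_exp: "set_integrable lborel {s..t} (\<lambda>u. exp (c * u :: real))"
  by (intro borel_integrable_atLeastAtMost' continuous_intros)

text \<open>Since \<phi> is merely integrable, integration by parts is done by Fubini on the
  triangle \<open>r \<le> s\<close>: the inner integral over \<open>{r..t}\<close> is the increment
  of the exponential.\<close>

lemma LBINT_exp_primitive:
  fixes \<phi> :: "real \<Rightarrow> real"
  assumes "\<gamma> > 0" "t \<ge> 0" and \<phi>: "set_integrable lborel {0..t} \<phi>"
  shows "(LBINT s:{0..t}. \<gamma> * exp (\<gamma> * s) * (LBINT r:{0..s}. \<phi> r)) =
    (LBINT r:{0..t}. (exp (\<gamma> * t) - exp (\<gamma> * r)) * \<phi> r)"
proof -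
  define \<phi>0 where "\<phi>0 r = indicator {0..t} r *\<^sub>R \<phi> r" for r
  define \<psi> where "\<psi> s = indicator {0..t} s *\<^sub>R (\<gamma> * exp (\<gamma> * s))" for s
  have i: "integrable lborel \<phi>0" "integrable lborel \<psi>"
    using \<phi> set_integrable_exp[of 0 t \<gamma>, THEN set_integrable_mult_right, of \<gamma>]
    by (simp_all add: \<phi>0_def[abs_def] \<psi>_def[abs_def] set_integrable_def)
  have [measurable]: "\<phi>0 \<in> borel_measurable borel" "\<psi> \<in> borel_measurable borel"
    using i[THEN borel_measurable_integrable] by simp_all
  have "integrable (lborel \<Otimes>\<^sub>M lborel) (\<lambda>z. \<phi>0 (fst z) * \<psi> (snd z))"
  proof (rule lborel_pair.Fubini_integrable)
    show "integrable lborel (\<lambda>r. LBINT s. norm (\<phi>0 (fst (r, s)) * \<psi> (snd (r, s))))"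
      using i by (simp add: abs_mult)
    show "AE r in lborel. integrable lborel (\<lambda>s. \<phi>0 (fst (r, s)) * \<psi> (snd (r, s)))"
      using i by simp
  qed measurable
  then have "integrable (lborel \<Otimes>\<^sub>M lborel) (\<lambda>z. indicator {z. fst z \<le> snd z} z *\<^sub>R (\<phi>0 (fst z) * \<psi> (snd z)))"
  proof (rule integrable_mult_indicator[rotated])
    have "{z \<in> space (lborel \<Otimes>\<^sub>M lborel :: (real \<times> real) measure). fst z \<le> snd z} \<in>
        sets (lborel \<Otimes>\<^sub>M lborel)"
      by measurable
    then show "{z. fst z \<le> snd z} \<in> sets (lborel \<Otimes>\<^sub>M lborel :: (real \<times> real) measure)"
      by (simp add: space_pair_measure)
  qed
  then have "(LBINT s. LBINT r. indicator {z. fst z \<le> snd z} (r, s) *\<^sub>R (\<phi>0 r * \<psi> s)) =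
      (LBINT r. LBINT s. indicator {z. fst z \<le> snd z} (r, s) *\<^sub>R (\<phi>0 r * \<psi> s))"
    by (intro lborel_pair.Fubini_integral) (simp add: case_prod_beta')
  also have "(\<lambda>s. LBINT r. indicator {z. fst z \<le> snd z} (r, s) *\<^sub>R (\<phi>0 r * \<psi> s)) =
      (\<lambda>s. indicator {0..t} s *\<^sub>R (\<gamma> * exp (\<gamma> * s) * (LBINT r:{0..s}. \<phi> r)))"
  proof
    fix s
    have "(LBINT r. indicator {z. fst z \<le> snd z} (r, s) *\<^sub>R (\<phi>0 r * \<psi> s)) =
        (LBINT r. \<psi> s * (indicator {0..s} r *\<^sub>R \<phi> r))"
      by (intro Bochner_Integration.integral_cong) (auto simp: \<phi>0_def \<psi>_def indicator_def)
    then show "(LBINT r. indicator {z. fst z \<le> snd z} (r, s) *\<^sub>R (\<phi>0 r * \<psi> s)) =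
        indicator {0..t} s *\<^sub>R (\<gamma> * exp (\<gamma> * s) * (LBINT r:{0..s}. \<phi> r))"
      by (simp add: set_lebesgue_integral_def \<psi>_def)
  qed
  also have "(\<lambda>r. LBINT s. indicator {z. fst z \<le> snd z} (r, s) *\<^sub>R (\<phi>0 r * \<psi> s)) =
      (\<lambda>r. indicator {0..t} r *\<^sub>R ((exp (\<gamma> * t) - exp (\<gamma> * r)) * \<phi> r))"
  proof
    fix r
    show "(LBINT s. indicator {z. fst z \<le> snd z} (r, s) *\<^sub>R (\<phi>0 r * \<psi> s)) =
        indicator {0..t} r *\<^sub>R ((exp (\<gamma> * t) - exp (\<gamma> * r)) * \<phi> r)"
    proof (cases "r \<in> {0..t}")
      case True
      then have "(LBINT s. indicator {z. fst z \<le> snd z} (r, s) *\<^sub>R (\<phi>0 r * \<psi> s)) =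
          (LBINT s. (\<phi> r * \<gamma>) * (indicator {r..t} s *\<^sub>R exp (\<gamma> * s)))"
        by (intro Bochner_Integration.integral_cong) (auto simp: \<phi>0_def \<psi>_def indicator_def)
      also have "\<dots> = (\<phi> r * \<gamma>) * (LBINT s:{r..t}. exp (\<gamma> * s))"
        by (simp add: set_lebesgue_integral_def)
      finally show ?thesis using True \<open>\<gamma> > 0\<close> by (simp add: LBINT_exp)
    qed (simp add: \<phi>0_def)
  qed
  finally show ?thesis by (simp add: set_lebesgue_integral_def)
qed

section \<open>Energy identities for a path with square-integrable derivative\<close>

context
  fixes \<alpha> \<gamma> T x :: real and f \<phi> :: "real \<Rightarrow> real"
  assumes \<gamma>: "\<gamma> > 0" and T: "T > 0"
    and deriv: "has_L2_derivative T x f \<phi>" and cont: "continuous_on {0..T} f"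
begin

lemma deriv_integrable: "set_integrable lborel {0..T} \<phi>"
  using deriv by (auto simp: has_L2_derivative_def intro: L2_path_integrable)

lemma drift_integrable: "set_integrable lborel {0..T} (\<lambda>s. exp (\<gamma> * s) * (\<phi> s - \<alpha> + \<gamma> * f s))"
proof -
  have "set_integrable lborel {0..T} (\<lambda>s. exp (\<gamma> * s) * \<phi> s)"
    by (intro set_integrable_continuous_mult deriv_integrable continuous_intros)
  moreover have "set_integrable lborel {0..T} (\<lambda>s. exp (\<gamma> * s) * (- \<alpha> + \<gamma> * f s))"
    by (intro borel_integrable_atLeastAtMost' continuous_intros cont)
  ultimately have "set_integrable lborel {0..T} (\<lambda>s. exp (\<gamma> * s) * \<phi> s + exp (\<gamma> * s) * (- \<alpha> + \<gamma> * f s))"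
    by (rule set_integral_add(1))
  then show ?thesis by (simp add: algebra_simps)
qed

text \<open>The integrand is the weak derivative of
  \<open>exp (\<gamma> * s) * (f s - \<alpha> / \<gamma>)\<close>, so the integral sees the end
  points only. \<open>LBINT_exp_primitive\<close> takes the place of the product rule.\<close>

lemma drift_exp_integral:
  assumes t: "t \<in> {0..T}"
  shows "(LBINT s:{0..t}. exp (\<gamma> * s) * (\<phi> s - \<alpha> + \<gamma> * f s)) =
    exp (\<gamma> * t) * f t - x - \<alpha> / \<gamma> * (exp (\<gamma> * t) - 1)"
proof -
  have sub: "{0..t} \<subseteq> {0..T}" using t by auto
  have \<phi>: "set_integrable lborel {0..t} \<phi>"
    by (rule set_integrable_subset[OF deriv_integrable]) (use sub in auto)
  have f: "f s = x + (LBINT r:{0..s}. \<phi> r)" if "s \<in> {0..t}" for s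
    using deriv sub that unfolding has_L2_derivative_def by blast
  have e\<phi>: "set_integrable lborel {0..t} (\<lambda>s. exp (\<gamma> * s) * \<phi> s)"
    by (intro set_integrable_continuous_mult \<phi> continuous_intros)
  have ef: "set_integrable lborel {0..t} (\<lambda>s. \<gamma> * exp (\<gamma> * s) * (f s - x))"
    by (intro borel_integrable_atLeastAtMost' continuous_intros continuous_on_subset[OF cont sub])
  have e: "(LBINT s:{0..t}. exp (\<gamma> * s)) = (exp (\<gamma> * t) - 1) / \<gamma>"
    using \<gamma> t by (simp add: LBINT_exp)
  have "(LBINT s:{0..t}. exp (\<gamma> * s) * (\<phi> s - \<alpha> + \<gamma> * f s)) =
      (LBINT s:{0..t}. exp (\<gamma> * s) * \<phi> s + \<gamma> * exp (\<gamma> * s) * (f s - x) + (\<gamma> * x - \<alpha>) * exp (\<gamma> * s))"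
    by (intro set_lebesgue_integral_cong) (auto simp: algebra_simps)
  also have "\<dots> = (LBINT s:{0..t}. exp (\<gamma> * s) * \<phi> s) + (LBINT s:{0..t}. \<gamma> * exp (\<gamma> * s) * (f s - x))
      + (\<gamma> * x - \<alpha>) * ((exp (\<gamma> * t) - 1) / \<gamma>)"
    using e\<phi> ef set_integrable_exp[of 0 t \<gamma>] by (simp add: set_integral_add e)
  also have "(LBINT s:{0..t}. \<gamma> * exp (\<gamma> * s) * (f s - x)) =
      (LBINT s:{0..t}. \<gamma> * exp (\<gamma> * s) * (LBINT r:{0..s}. \<phi> r))"
    by (intro set_lebesgue_integral_cong) (auto simp: f)
  also have "\<dots> = (LBINT r:{0..t}. (exp (\<gamma> * t) - exp (\<gamma> * r)) * \<phi> r)"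
    using t by (intro LBINT_exp_primitive \<gamma> \<phi>) auto
  also have "\<dots> = (LBINT r:{0..t}. exp (\<gamma> * t) * \<phi> r) - (LBINT r:{0..t}. exp (\<gamma> * r) * \<phi> r)"
    unfolding left_diff_distrib using \<phi> e\<phi> by (intro set_integral_diff) auto
  also have "(LBINT r:{0..t}. exp (\<gamma> * t) * \<phi> r) = exp (\<gamma> * t) * (f t - x)"
    using f[of t] t by simp
  finally show ?thesis using \<gamma> by (simp add: field_simps)
qed

lemma drift_square_integrable: "set_integrable lborel {0..T} (\<lambda>s. (\<phi> s - \<alpha> + \<gamma> * f s)\<^sup>2)"
proof -
  have "set_integrable lborel {0..T} (\<lambda>s. (\<phi> s)\<^sup>2)"
    using deriv by (simp add: has_L2_derivative_def L2_path_def)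
  moreover have "set_integrable lborel {0..T} (\<lambda>s. (2 * (- \<alpha> + \<gamma> * f s)) * \<phi> s)"
    by (intro set_integrable_continuous_mult deriv_integrable continuous_intros cont)
  moreover have "set_integrable lborel {0..T} (\<lambda>s. (- \<alpha> + \<gamma> * f s)\<^sup>2)"
    by (intro borel_integrable_atLeastAtMost' continuous_intros cont)
  ultimately have "set_integrable lborel {0..T} (\<lambda>s. (\<phi> s)\<^sup>2 + (2 * (- \<alpha> + \<gamma> * f s)) * \<phi> s + (- \<alpha> + \<gamma> * f s)\<^sup>2)"
    by (intro set_integral_add(1))
  moreover have "(\<phi> s)\<^sup>2 + (2 * (- \<alpha> + \<gamma> * f s)) * \<phi> s + (- \<alpha> + \<gamma> * f s)\<^sup>2 = (\<phi> s - \<alpha> + \<gamma> * f s)\<^sup>2" for s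
    by (simp add: power2_eq_square algebra_simps)
  ultimately show ?thesis by simp
qed

text \<open>Expanding the square, the cross term is known from \<open>drift_exp_integral\<close> and
  the last term integrates to \<open>exp_var \<gamma> T\<close>. Completing the square later amounts
  to a choice of \<open>c\<close>.\<close>

lemma drift_residual:
  fixes c :: real
  shows "set_integrable lborel {0..T} (\<lambda>s. (\<phi> s - \<alpha> + \<gamma> * f s - c * exp (\<gamma> * s))\<^sup>2)" (is ?I)
    and "(LBINT s:{0..T}. (\<phi> s - \<alpha> + \<gamma> * f s - c * exp (\<gamma> * s))\<^sup>2) =
      (LBINT s:{0..T}. (\<phi> s - \<alpha> + \<gamma> * f s)\<^sup>2)
      - 2 * c * (exp (\<gamma> * T) * f T - x - \<alpha> / \<gamma> * (exp (\<gamma> * T) - 1)) + c\<^sup>2 * exp_var \<gamma> T" (is ?E)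
proof -
  have eq: "(\<phi> s - \<alpha> + \<gamma> * f s - c * exp (\<gamma> * s))\<^sup>2 = (\<phi> s - \<alpha> + \<gamma> * f s)\<^sup>2
      - 2 * c * (exp (\<gamma> * s) * (\<phi> s - \<alpha> + \<gamma> * f s)) + c\<^sup>2 * exp (2 * \<gamma> * s)" for s
  proof -
    have "exp (2 * \<gamma> * s) = (exp (\<gamma> * s))\<^sup>2" by (simp add: mult.assoc exp_double)
    then show ?thesis by (simp only:) (simp add: power2_eq_square algebra_simps)
  qed
  have 1: "set_integrable lborel {0..T} (\<lambda>s. 2 * c * (exp (\<gamma> * s) * (\<phi> s - \<alpha> + \<gamma> * f s)))"
    by (intro set_integrable_mult_right) (rule drift_integrable)
  have 2: "set_integrable lborel {0..T} (\<lambda>s. c\<^sup>2 * exp (2 * \<gamma> * s))"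
    by (intro set_integrable_mult_right) (rule set_integrable_exp)
  note d = set_integral_diff[OF drift_square_integrable 1]
  note a = set_integral_add[OF d(1) 2]
  show ?I unfolding eq by (rule a(1))
  have "(LBINT s:{0..T}. exp (2 * \<gamma> * s)) = exp_var \<gamma> T"
    using \<gamma> T by (simp add: LBINT_exp exp_var_def)
  moreover have "T \<in> {0..T}" using T by simp
  ultimately show ?E unfolding eq a(2) d(2) set_integral_mult_right drift_exp_integral[OF \<open>T \<in> {0..T}\<close>]
    by simp
qed

text \<open>Information almost everywhere on the derivative fixes the path at every time, because
  \<open>drift_exp_integral\<close> recovers \<open>f t\<close> from an integral.\<close>

lemma drift_proportional_imp_path:
  assumes ae: "AE s in lborel. s \<in> {0..T} \<longrightarrow> \<phi> s - \<alpha> + \<gamma> * f s = c * exp (\<gamma> * s)" and t: "t \<in> {0..T}"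
  shows "exp (\<gamma> * t) * f t = x + \<alpha> / \<gamma> * (exp (\<gamma> * t) - 1) + c * exp_var \<gamma> t"
proof -
  have i: "set_integrable lborel {0..t} (\<lambda>s. exp (\<gamma> * s) * (\<phi> s - \<alpha> + \<gamma> * f s))"
    by (rule set_integrable_subset[OF drift_integrable]) (use t in auto)
  have j: "set_integrable lborel {0..t} (\<lambda>s. c * exp (2 * \<gamma> * s))"
    by (intro set_integrable_mult_right) (rule set_integrable_exp)
  have "exp (\<gamma> * t) * f t - x - \<alpha> / \<gamma> * (exp (\<gamma> * t) - 1) =
      (LBINT s:{0..t}. exp (\<gamma> * s) * (\<phi> s - \<alpha> + \<gamma> * f s))"
    using drift_exp_integral[OF t] ..
  also have "\<dots> = (LBINT s:{0..t}. c * exp (2 * \<gamma> * s))"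
    unfolding set_lebesgue_integral_def
  proof (rule integral_cong_AE)
    show "AE s in lborel. indicator {0..t} s *\<^sub>R (exp (\<gamma> * s) * (\<phi> s - \<alpha> + \<gamma> * f s)) =
        indicator {0..t} s *\<^sub>R (c * exp (2 * \<gamma> * s))"
      using ae
    proof eventually_elim
      case (elim s)
      show ?case
      proof (cases "s \<in> {0..t}")
        case True
        then have "\<phi> s - \<alpha> + \<gamma> * f s = c * exp (\<gamma> * s)" using elim t by auto
        then show ?thesis by (simp add: mult_exp_exp algebra_simps)
      qed simp
    qed
  qed (use i j in \<open>auto simp: set_integrable_def dest: borel_measurable_integrable\<close>)
  also have "\<dots> = c * exp_var \<gamma> t"
    using \<gamma> t by (simp add: LBINT_exp exp_var_def)
  finally show ?thesis by simp
qed

end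

lemma has_L2_derivative_C1:
  fixes F \<phi> :: "real \<Rightarrow> real"
  assumes F: "\<And>t. (F has_real_derivative \<phi> t) (at t)" and \<phi>: "continuous_on UNIV \<phi>"
    and f: "\<And>t. t \<in> {0..T} \<Longrightarrow> f t = F t"
  shows "has_L2_derivative T (F 0) f \<phi>"
proof -
  have c: "continuous_on A \<phi>" for A using \<phi> by (rule continuous_on_subset) simp
  have "set_borel_measurable lborel {0..T} \<phi>"
    unfolding set_borel_measurable_def
    using borel_measurable_continuous_on_indicator[OF _ c, of "{0..T}"] by simp
  moreover have "set_integrable lborel {0..T} (\<lambda>t. (\<phi> t)\<^sup>2)"
    by (intro borel_integrable_atLeastAtMost' continuous_intros c)
  moreover have "(LBINT s:{0..t}. \<phi> s) = F t - F 0" if "t \<in> {0..T}" for t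
    unfolding set_lebesgue_integral_def using that F c
    by (intro integral_FTC_atLeastAtMost)
      (auto simp flip: has_real_derivative_iff_has_vector_derivative intro: has_field_derivative_at_within)
  ultimately show ?thesis using f by (simp add: has_L2_derivative_def L2_path_def)
qed

section \<open>Identification of the minimizer\<close>

context
  fixes \<alpha> \<gamma> \<sigma> T d x b :: real
  assumes \<alpha>: "\<alpha> > 0" and \<gamma>: "\<gamma> > 0" and \<sigma>: "\<sigma> > 0" and T: "T > 0"
    and d: "d > \<alpha> / \<gamma>" and x: "x \<in> {0..d}" and bd: "b \<le> d"
    and b: "b > \<alpha> / \<gamma> + (x - \<alpha> / \<gamma>) * exp (- \<gamma> * T)"
begin

text \<open>The value that the scaled noise integral must take at time \<open>T\<close> for the
  unreflected equation to lead from \<open>x\<close> to \<open>b\<close>.\<close>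

definition noise_cost :: real where
  "noise_cost = exp (\<gamma> * T) * b - x - \<alpha> / \<gamma> * (exp (\<gamma> * T) - 1)"

private abbreviation (input) "C \<equiv> (b - \<alpha> / \<gamma> + \<alpha> / \<gamma> * exp (\<gamma> * T) - x * exp (- \<gamma> * T)) /
  (exp (\<gamma> * T) - exp (- \<gamma> * T))"

private abbreviation (input) "F t \<equiv> (C - \<alpha> / \<gamma>) * exp (\<gamma> * t) + (x - C) * exp (- \<gamma> * t) + \<alpha> / \<gamma>"

private abbreviation (input) "f_star \<equiv> (\<lambda>t\<in>{0..T}. F t)"

lemma noise_cost_eq:
  "noise_cost = exp (\<gamma> * T) * (b - (\<alpha> / \<gamma> + (x - \<alpha> / \<gamma>) * exp (- \<gamma> * T)))"
  by (simp add: noise_cost_def algebra_simps mult_exp_exp)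

lemma noise_cost_pos: "noise_cost > 0"
  unfolding noise_cost_eq using b by (intro mult_pos_pos) simp_all

lemma b_nonneg: "b \<ge> 0"
proof -
  have "\<alpha> / \<gamma> * exp (- \<gamma> * T) \<le> \<alpha> / \<gamma> * 1" using \<alpha> \<gamma> T by (intro mult_left_mono) auto
  moreover have "x * exp (- \<gamma> * T) \<ge> 0" using x by simp
  ultimately show ?thesis using b by (simp add: left_diff_distrib)
qed

text \<open>For the candidate \<open>F\<close>, the expression F' - \<alpha> + \<gamma> F equals
  \<open>2 * \<gamma> * (C - \<alpha> / \<gamma>) * exp (\<gamma> * t)\<close>. So \<open>C\<close>
  is the constant for which the forcing has the optimal coefficient.\<close>

lemma f_star_coefficient: "2 * \<gamma> * (C - \<alpha> / \<gamma>) = noise_cost / exp_var \<gamma> T"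
proof -
  define v a where "v = exp (\<gamma> * T)" and "a = \<alpha> / \<gamma>"
  have "v > 1" using \<gamma> T by (simp add: v_def)
  then have v: "v * v > 1" "v \<noteq> 0" using mult_strict_mono[of 1 v 1 v] by auto
  have "(b - a + a * v - x * (1 / v)) / (v - 1 / v) - a = (v * b - x - a * (v - 1)) / (v * v - 1)"
    using v by (simp add: divide_simps) (simp add: algebra_simps)
  moreover have "exp (- \<gamma> * T) = 1 / v" by (simp add: v_def exp_minus divide_inverse)
  moreover have "exp (2 * \<gamma> * T) = v * v" by (simp add: v_def mult_exp_exp)
  ultimately show ?thesis using \<gamma>
    by (simp add: noise_cost_def exp_var_def flip: v_def a_def)
qed

lemma exp_f_star:
  "exp (\<gamma> * t) * F t = x + \<alpha> / \<gamma> * (exp (\<gamma> * t) - 1) + noise_cost / exp_var \<gamma> T * exp_var \<gamma> t"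
proof -
  define u where "u = exp (\<gamma> * t)"
  have e: "exp (- \<gamma> * t) = 1 / u" "exp (2 * \<gamma> * t) = u * u" "u \<noteq> 0"
    by (simp_all add: u_def exp_minus divide_inverse mult_exp_exp)
  have "u * ((c - a) * u + (x - c) * (1 / u) + a) = x + a * (u - 1) + 2 * \<gamma> * (c - a) * ((u * u - 1) / (2 * \<gamma>))"
    for c a using e(3) \<gamma> by (simp add: field_simps)
  then show ?thesis unfolding exp_var_def[of \<gamma> t] f_star_coefficient[symmetric] e u_def[symmetric] .
qed

lemma eq_f_star_iff:
  "y = F t \<longleftrightarrow> exp (\<gamma> * t) * y =
    x + \<alpha> / \<gamma> * (exp (\<gamma> * t) - 1) + noise_cost / exp_var \<gamma> T * exp_var \<gamma> t"
  unfolding exp_f_star[symmetric] by simp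

lemma f_star_ends: "F 0 = x" "F T = b"
proof -
  show "F 0 = x" by simp
  have "exp_var \<gamma> T > 0" by (rule exp_var_pos[OF \<gamma> T])
  then have "b = F T" unfolding eq_f_star_iff by (simp add: noise_cost_def)
  then show "F T = b" ..
qed

text \<open>By \<open>exp_f_star\<close> the candidate is the optimal path from \<open>x\<close> to
  \<open>b\<close>, and the equilibrium and both end points lie in [0, d].\<close>

lemma f_star_bounds:
  assumes t: "t \<in> {0..T}"
  shows "0 \<le> F t" "F t \<le> d"
proof -
  have "exp (\<gamma> * t) * F t \<le> exp (\<gamma> * t) * d" unfolding exp_f_star
    using optimal_path_le[OF \<gamma> T t, of "\<alpha> / \<gamma>" d x b] d x bd by (simp add: noise_cost_def mult.commute[of d])
  then show "F t \<le> d" by (simp only: mult_le_cancel_left_pos exp_gt_zero)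
  have "exp (\<gamma> * t) * 0 \<le> exp (\<gamma> * t) * F t" unfolding exp_f_star
    using optimal_path_ge[OF \<gamma> T t, of 0 "\<alpha> / \<gamma>" x b] \<alpha> \<gamma> x b_nonneg by (simp add: noise_cost_def)
  then show "0 \<le> F t" by (simp only: mult_le_cancel_left_pos exp_gt_zero)
qed

lemma f_star_deriv:
  "has_L2_derivative T x f_star (\<lambda>t. \<gamma> * (C - \<alpha> / \<gamma>) * exp (\<gamma> * t) - \<gamma> * (x - C) * exp (- \<gamma> * t))"
proof -
  have "has_L2_derivative T (F 0) f_star (\<lambda>t. \<gamma> * (C - \<alpha> / \<gamma>) * exp (\<gamma> * t) - \<gamma> * (x - C) * exp (- \<gamma> * t))"
  proof (rule has_L2_derivative_C1)
    fix t show "(F has_real_derivative \<gamma> * (C - \<alpha> / \<gamma>) * exp (\<gamma> * t) - \<gamma> * (x - C) * exp (- \<gamma> * t)) (at t)"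
      by (auto intro!: derivative_eq_intros)
  qed (auto intro!: continuous_intros)
  then show ?thesis unfolding f_star_ends .
qed

lemma f_star_Spp: "f_star \<in> Spp T d x b"
proof -
  have "continuous_on {0..T} f_star \<longleftrightarrow> continuous_on {0..T} F" by (intro continuous_on_cong) auto
  moreover have "continuous_on {0..T} F" by (intro continuous_intros)
  ultimately have "f_star \<in> path_space T d" using f_star_bounds by (auto simp: path_space_def)
  then show ?thesis using f_star_ends T by (simp add: Spp_def)
qed

lemma f_star_Hpp: "f_star \<in> Hpp T d x"
  using f_star_deriv f_star_bounds by (auto simp: Hpp_def H_def)

definition residual :: "(real \<Rightarrow> real) \<Rightarrow> real" where
  "residual h = (LBINT s:{0..T}.
    (path_deriv T x h s - \<alpha> + \<gamma> * h s - noise_cost / exp_var \<gamma> T * exp (\<gamma> * s))\<^sup>2)"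

lemma residual_nonneg: "residual h \<ge> 0"
  unfolding residual_def set_lebesgue_integral_def
  by (intro Bochner_Integration.integral_nonneg) (simp add: indicator_def)

context
  fixes h :: "real \<Rightarrow> real"
  assumes h: "h \<in> Spp T d x b" and H: "h \<in> Hpp T d x"
begin

lemma has_path_deriv: "has_L2_derivative T x h (path_deriv T x h)"
  using H by (auto simp: Hpp_def H_def intro: path_deriv_eq(1))

lemma path_continuous: "continuous_on {0..T} h"
  using h by (simp add: Spp_def path_space_def)

lemma residual_eq_0_iff:
  "residual h = 0 \<longleftrightarrow> (AE s in lborel. s \<in> {0..T} \<longrightarrow>
    path_deriv T x h s - \<alpha> + \<gamma> * h s = noise_cost / exp_var \<gamma> T * exp (\<gamma> * s))"
proof -
  let ?r = "\<lambda>s. path_deriv T x h s - \<alpha> + \<gamma> * h s - noise_cost / exp_var \<gamma> T * exp (\<gamma> * s)"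
  have "residual h = 0 \<longleftrightarrow> (AE s in lborel. indicator {0..T} s *\<^sub>R (?r s)\<^sup>2 = 0)"
    unfolding residual_def set_lebesgue_integral_def
  proof (rule integral_nonneg_eq_0_iff_AE)
    show "integrable lborel (\<lambda>s. indicator {0..T} s *\<^sub>R (?r s)\<^sup>2)"
      using drift_residual(1)[OF \<gamma> T has_path_deriv path_continuous] unfolding set_integrable_def .
  qed (simp add: indicator_def)
  also have "\<dots> \<longleftrightarrow> (AE s in lborel. s \<in> {0..T} \<longrightarrow> ?r s = 0)"
    by (intro AE_cong) (auto simp: indicator_def)
  finally show ?thesis by simp
qed

text \<open>The cross term of the square depends on \<open>h\<close> through \<open>h T\<close> only.\<close>

lemma rate_square:
  "rate_pp \<alpha> \<gamma> \<sigma> T d x h = ereal (1 / (2 * \<sigma>\<^sup>2) *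
    (noise_cost\<^sup>2 / exp_var \<gamma> T + residual h +
      2 * (noise_cost / exp_var \<gamma> T) * (exp (\<gamma> * T) * (h T - b))))"
proof -
  define c where "c = noise_cost / exp_var \<gamma> T"
  have "exp_var \<gamma> T > 0" by (rule exp_var_pos[OF \<gamma> T])
  then have c: "c\<^sup>2 * exp_var \<gamma> T = noise_cost\<^sup>2 / exp_var \<gamma> T" "c * noise_cost = noise_cost\<^sup>2 / exp_var \<gamma> T"
    by (simp_all add: c_def power2_eq_square field_simps)
  have "exp (\<gamma> * T) * h T - x - \<alpha> / \<gamma> * (exp (\<gamma> * T) - 1) = noise_cost + exp (\<gamma> * T) * (h T - b)"
    by (simp add: noise_cost_def algebra_simps)
  then have "residual h = (LBINT s:{0..T}. (path_deriv T x h s - \<alpha> + \<gamma> * h s)\<^sup>2) -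
      2 * (c * noise_cost) - 2 * c * (exp (\<gamma> * T) * (h T - b)) + c\<^sup>2 * exp_var \<gamma> T"
    unfolding residual_def drift_residual(2)[OF \<gamma> T has_path_deriv path_continuous] c_def[symmetric]
    by (simp only: distrib_left)
  then have I: "(LBINT s:{0..T}. (path_deriv T x h s - \<alpha> + \<gamma> * h s)\<^sup>2) =
      noise_cost\<^sup>2 / exp_var \<gamma> T + residual h + 2 * c * (exp (\<gamma> * T) * (h T - b))"
    unfolding c by simp
  show ?thesis unfolding rate_pp_def I c_def using H by simp
qed

end

text \<open>The end-point term is nonnegative because \<open>h T \<ge> b\<close> and
  \<open>noise_cost\<close> is positive. Keeping the residual in the bound yields uniqueness along
  with minimality; outside \<open>Hpp\<close> the rate is infinite.\<close>

lemma rate_ge: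
  assumes "h \<in> Spp T d x b"
  shows "ereal (1 / (2 * \<sigma>\<^sup>2) * (noise_cost\<^sup>2 / exp_var \<gamma> T + residual h)) \<le> rate_pp \<alpha> \<gamma> \<sigma> T d x h"
proof (cases "h \<in> Hpp T d x")
  case True
  have "h T \<ge> b" using assms by (simp add: Spp_def)
  then have "2 * (noise_cost / exp_var \<gamma> T) * (exp (\<gamma> * T) * (h T - b)) \<ge> 0"
    using noise_cost_pos exp_var_pos[OF \<gamma> T] by simp
  then show ?thesis unfolding rate_square[OF assms True] ereal_less_eq(3)
    by (intro mult_left_mono) auto
qed (simp add: rate_pp_def)

lemma rate_f_star: "rate_pp \<alpha> \<gamma> \<sigma> T d x f_star = ereal (1 / (2 * \<sigma>\<^sup>2) * (noise_cost\<^sup>2 / exp_var \<gamma> T))"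
proof -
  have "AE s in lborel. s \<in> {0..T} \<longrightarrow>
      path_deriv T x f_star s - \<alpha> + \<gamma> * f_star s = noise_cost / exp_var \<gamma> T * exp (\<gamma> * s)"
    using path_deriv_eq(2)[OF f_star_deriv]
  proof eventually_elim
    case (elim s)
    \<comment> \<open>The decaying mode cancels, and twice the growing mode remains.\<close>
    have "(\<gamma> * A * u - \<gamma> * D * w) - \<alpha> + \<gamma> * (A * u + D * w + \<alpha> / \<gamma>) = 2 * \<gamma> * A * u" for A D u w
      using \<gamma> by (simp add: algebra_simps)
    then show ?case using elim unfolding f_star_coefficient[symmetric]
      by (intro impI) (simp only: restrict_apply' simp_thms)
  qed
  then have "residual f_star = 0" unfolding residual_eq_0_iff[OF f_star_Spp f_star_Hpp] .
  moreover have "f_star T = b" using f_star_ends(2) T by simp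
  ultimately show ?thesis unfolding rate_square[OF f_star_Spp f_star_Hpp] by simp
qed

text \<open>Comparison with \<open>f_star\<close> makes the rate of a minimizer finite and its
  residual zero. The forcing is then optimal almost everywhere, which determines the path on
  \<open>{0..T}\<close>; extensionality settles the remaining arguments.\<close>

lemma unique_minimizer:
  "is_arg_min (rate_pp \<alpha> \<gamma> \<sigma> T d x) (\<lambda>f. f \<in> Spp T d x b) f \<longleftrightarrow> f = f_star"
proof
  assume f: "is_arg_min (rate_pp \<alpha> \<gamma> \<sigma> T d x) (\<lambda>f. f \<in> Spp T d x b) f"
  then have S: "f \<in> Spp T d x b" by (simp add: is_arg_min_def)
  have le: "rate_pp \<alpha> \<gamma> \<sigma> T d x f \<le> rate_pp \<alpha> \<gamma> \<sigma> T d x f_star"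
    using f f_star_Spp unfolding is_arg_min_def by (meson not_le)
  have H: "f \<in> Hpp T d x"
    using le unfolding rate_f_star by (auto simp: rate_pp_def split: if_splits)
  have pos: "1 / (2 * \<sigma>\<^sup>2) > 0" using \<sigma> by simp
  have "residual f \<le> 0"
    using order_trans[OF rate_ge[OF S] le] unfolding rate_f_star ereal_less_eq(3) mult_le_cancel_left_pos[OF pos]
    by linarith
  then have "residual f = 0" using residual_nonneg[of f] by simp
  note ae = this[unfolded residual_eq_0_iff[OF S H]]
  show "f = f_star"
  proof (rule extensionalityI[of _ "{0..T}"])
    show "f \<in> extensional {0..T}" using S by (auto simp: Spp_def path_space_def PiE_def)
    fix t assume t: "t \<in> {0..T}"
    have "f t = F t" unfolding eq_f_star_iff
      by (rule drift_proportional_imp_path[OF \<gamma> T has_path_deriv[OF S H] path_continuous[OF S H] ae t])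
    then show "f t = f_star t" using t by simp
  qed simp
next
  assume f: "f = f_star"
  have "rate_pp \<alpha> \<gamma> \<sigma> T d x f_star \<le> rate_pp \<alpha> \<gamma> \<sigma> T d x h" if h: "h \<in> Spp T d x b" for h
  proof (rule order_trans[OF _ rate_ge[OF h]])
    show "rate_pp \<alpha> \<gamma> \<sigma> T d x f_star \<le> ereal (1 / (2 * \<sigma>\<^sup>2) * (noise_cost\<^sup>2 / exp_var \<gamma> T + residual h))"
      unfolding rate_f_star ereal_less_eq(3) using residual_nonneg[of h] by (intro mult_left_mono) auto
  qed
  then show "is_arg_min (rate_pp \<alpha> \<gamma> \<sigma> T d x) (\<lambda>f. f \<in> Spp T d x b) f"
    unfolding is_arg_min_def f using f_star_Spp by (meson not_le)
qed

text \<open>Numerator and denominator are divided by \<open>exp (2 * \<gamma> * T)\<close>.\<close>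

lemma rate_formula:
  "noise_cost\<^sup>2 / (2 * exp_var \<gamma> T * \<sigma>\<^sup>2) =
    (b - (\<alpha> / \<gamma> + (x - \<alpha> / \<gamma>) * exp (- \<gamma> * T)))\<^sup>2 / ((1 - exp (- 2 * \<gamma> * T)) * \<sigma>\<^sup>2 / \<gamma>)"
proof -
  define v m where "v = exp (\<gamma> * T)" and "m = b - (\<alpha> / \<gamma> + (x - \<alpha> / \<gamma>) * exp (- \<gamma> * T))"
  have "v > 1" using \<gamma> T by (simp add: v_def)
  then have v: "v * v > 1" "v \<noteq> 0" using mult_strict_mono[of 1 v 1 v] by auto
  have "exp (2 * \<gamma> * T) = v * v" by (simp add: v_def mult_exp_exp)
  moreover have "exp (- 2 * \<gamma> * T) = 1 / (v * v)"
    by (simp add: v_def mult_exp_exp exp_minus divide_inverse)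
  moreover have "(v * m)\<^sup>2 / (2 * ((v * v - 1) / (2 * \<gamma>)) * \<sigma>\<^sup>2) = m\<^sup>2 / ((1 - 1 / (v * v)) * \<sigma>\<^sup>2 / \<gamma>)"
    using v \<gamma> \<sigma> by (simp add: divide_simps) (simp add: power2_eq_square algebra_simps)
  ultimately show ?thesis
    unfolding noise_cost_eq exp_var_def v_def[symmetric] m_def[symmetric] by simp
qed

end

text \<open>The limit is claimed for \<open>b < d\<close>, where the optimal path keeps a distance
  from the upper barrier; at \<open>b = d\<close> the event is that the path sits exactly on that
  barrier at time \<open>T\<close>. The minimizer is treated for all \<open>b \<le> d\<close>, and
  the equivalence contains both existence and uniqueness.\<close>

theorem theorem4p2:
  fixes M :: "'a measure" and B :: "real \<Rightarrow> 'a \<Rightarrow> real"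
    and Z L U :: "real \<Rightarrow> real \<Rightarrow> 'a \<Rightarrow> real"
    and \<alpha> \<gamma> \<sigma> T d x b :: real
  assumes "\<alpha> > 0" and "\<gamma> > 0" and "\<sigma> > 0" and "T > 0" and "d > \<alpha> / \<gamma>" and "x \<in> {0..d}"
    and "standard_brownian_motion M B"
    and "\<And>\<epsilon>. \<epsilon> > 0 \<Longrightarrow>
      doubly_reflected_OU M B \<alpha> \<gamma> (sqrt \<epsilon> * \<sigma>) d x (Z \<epsilon>) (L \<epsilon>) (U \<epsilon>)"
    and "d \<ge> b" and "b > \<alpha> / \<gamma> + (x - \<alpha> / \<gamma>) * exp (- \<gamma> * T)"
  shows "(b < d \<longrightarrow>
           ((\<lambda>\<epsilon>. \<epsilon> * ln (measure M {\<omega> \<in> space M. Z \<epsilon> T \<omega> \<ge> b})) \<longlongrightarrow>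
             - ((b - (\<alpha> / \<gamma> + (x - \<alpha> / \<gamma>) * exp (- \<gamma> * T)))\<^sup>2 /
                ((1 - exp (- 2 * \<gamma> * T)) * \<sigma>\<^sup>2 / \<gamma>))) (at_right 0)) \<and>
         (let C = (b - \<alpha> / \<gamma> + \<alpha> / \<gamma> * exp (\<gamma> * T) - x * exp (- \<gamma> * T)) /
                  (exp (\<gamma> * T) - exp (- \<gamma> * T));
              f_star = (\<lambda>t\<in>{0..T}. (C - \<alpha> / \<gamma>) * exp (\<gamma> * t) + (x - C) * exp (- \<gamma> * t) + \<alpha> / \<gamma>)
          in \<forall>f. is_arg_min (rate_pp \<alpha> \<gamma> \<sigma> T d x) (\<lambda>f. f \<in> Spp T d x b) f \<longleftrightarrow> f = f_star)"
  unfolding Let_def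
proof (intro conjI impI allI)
  assume "b < d"
  interpret brownian M B \<gamma> T using assms by unfold_locales
  note h = assms(1-6,9,10)
  note cost = noise_cost_pos[OF h] rate_formula[OF h]
  show "((\<lambda>\<epsilon>. \<epsilon> * ln (prob {\<omega> \<in> space M. Z \<epsilon> T \<omega> \<ge> b})) \<longlongrightarrow>
      - ((b - (\<alpha> / \<gamma> + (x - \<alpha> / \<gamma>) * exp (- \<gamma> * T)))\<^sup>2 /
        ((1 - exp (- 2 * \<gamma> * T)) * \<sigma>\<^sup>2 / \<gamma>))) (at_right 0)"
    using log_prob[OF assms(1,3,5,6) \<open>b < d\<close> assms(8)] cost
    unfolding noise_cost_def[OF h] by simp
qed (rule unique_minimizer[OF assms(1-6,9,10)])

end
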